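(* Let $X$ be a Tychonoff space and let $L(X)$ be the free locally convex space over $X$. The following assertions are equivalent: (i) $L(X)$ is a $(DF)$-space; (ii) $L(X)$ is an almost $(DF)$-space; (iii) $X$ is a countable discrete space.
   Context: Locally convex spaces (lcs) are real and Hausdorff; Tychonoff means completely regular and Hausdorff; countable includes finite. The free locally convex space over a Tychonoff space $X$ is an lcs $L(X)$ with a continuous map $i:X\to L(X)$ such that for every continuous map $f$ from $X$ to an lcs $E$ there is a unique continuous linear operator $\bar f:L(X)\to E$ with $f=\bar f\circ i$. It exists and is essentially unique, and $i$ is a topological embedding whose image is a Hamel basis of $L(X)$. For an lcs $E$ with dual $E'$, $\beta(E',E)$ is the strong topology (uniform convergence on bounded subsets of $E$). A subset of $E'$ is equicontinuous if it is contained in the polar $U^\circ=\{\chi\in E':|\chi(x)|\le 1\ \forall x\in U\}$ of some neighborhood $U$ of zero in $E$. $E$ is $\aleph_0$-quasibarrelled if every $\beta(E',E)$-bounded subset of $E'$ which is a countable union of equicontinuous sets is itself equicontinuous; $E$ is $\ell_\infty$-quasibarrelled if every $\beta(E',E)$-bounded sequence in $E'$ is equicontinuous. A fundamental bounded sequence in $E$ is an increasing sequence $(B_n)_{n\in\mathbb{N}}$ of bounded subsets of $E$ such that every bounded subset of $E$ is contained in some $B_n$. $E$ is a $(DF)$-space (respectively, an almost $(DF)$-space) if it has a fundamental bounded sequence and is $\aleph_0$-quasibarrelled (respectively, $\ell_\infty$-quasibarrelled). *)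

theory Defs
  imports "HOL-Analysis.Analysis" "HOL-Library.Function_Algebras"
begin

text \<open>Pointwise scalar multiplication: function spaces such as the dual of a locally convex
  space become subspaces of real vector spaces.\<close>

instantiation "fun" :: (type, scaleR) scaleR
begin

definition "c *\<^sub>R f = (\<lambda>x. c *\<^sub>R f x)"
instance ..

end

lemma scaleR_fun_apply [simp]: "(c *\<^sub>R f) x = c *\<^sub>R f x"
  by (simp add: scaleR_fun_def)

instance "fun" :: (type, real_vector) real_vector
  by standard (simp_all add: fun_eq_iff scaleR_add_right scaleR_add_left)


section \<open>Locally convex spaces\<close>

text \<open>A locally convex space is a topology whose underlying set is a linear subspace of some
  ambient real vector space; the ambient space carries no topology of its own.\<close>

definition lcs :: "'v::real_vector topology \<Rightarrow> bool" where
  "lcs E \<longleftrightarrow>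
     subspace (topspace E) \<and>
     continuous_map (prod_topology E E) E (\<lambda>(x, y). x + y) \<and>
     continuous_map (prod_topology euclideanreal E) E (\<lambda>(c, x). c *\<^sub>R x) \<and>
     Hausdorff_space E \<and>
     neighbourhood_base_of convex E"

definition zero_neighbourhood :: "'v::real_vector topology \<Rightarrow> 'v set \<Rightarrow> bool" where
  "zero_neighbourhood E U \<longleftrightarrow> U \<subseteq> topspace E \<and> (\<exists>V. openin E V \<and> 0 \<in> V \<and> V \<subseteq> U)"

definition bounded_in :: "'v::real_vector topology \<Rightarrow> 'v set \<Rightarrow> bool" where
  "bounded_in E A \<longleftrightarrow> A \<subseteq> topspace E \<and>
     (\<forall>U. zero_neighbourhood E U \<longrightarrow> (\<exists>s>0. \<forall>t>s. A \<subseteq> (*\<^sub>R) t ` U))"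

definition linear_map_on :: "'v::real_vector set \<Rightarrow> ('v \<Rightarrow> 'w::real_vector) \<Rightarrow> bool" where
  "linear_map_on V f \<longleftrightarrow>
     (\<forall>x\<in>V. \<forall>y\<in>V. f (x + y) = f x + f y) \<and> (\<forall>c. \<forall>x\<in>V. f (c *\<^sub>R x) = c *\<^sub>R f x)"

text \<open>The value 0 outside the domain only makes a map between carriers a unique HOL function.\<close>

definition continuous_linear ::
    "'v::real_vector topology \<Rightarrow> 'w::real_vector topology \<Rightarrow> ('v \<Rightarrow> 'w) set" where
  "continuous_linear E F =
     {f. linear_map_on (topspace E) f \<and> continuous_map E F f \<and> (\<forall>x. x \<notin> topspace E \<longrightarrow> f x = 0)}"

definition dual :: "'v::real_vector topology \<Rightarrow> ('v \<Rightarrow> real) set" where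
  "dual E = continuous_linear E euclideanreal"


section \<open>Quasibarrelledness conditions and (DF)-spaces\<close>

definition strong_dual :: "'v::real_vector topology \<Rightarrow> ('v \<Rightarrow> real) topology" where
  "strong_dual E = topology (\<lambda>W. W \<subseteq> dual E \<and>
     (\<forall>\<phi>\<in>W. \<exists>B \<epsilon>. bounded_in E B \<and> \<epsilon> > 0 \<and>
        {\<psi> \<in> dual E. \<forall>x\<in>B. \<bar>\<psi> x - \<phi> x\<bar> < \<epsilon>} \<subseteq> W))"

lemma bounded_in_empty: "bounded_in E {}"
  by (auto simp: bounded_in_def intro: exI[of _ 1])

lemma bounded_in_Un:
  assumes "bounded_in E A" "bounded_in E B"
  shows "bounded_in E (A \<union> B)"
  unfolding bounded_in_def
proof (intro conjI allI impI)
  show "A \<union> B \<subseteq> topspace E"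
    using assms by (auto simp: bounded_in_def)
  fix U assume U: "zero_neighbourhood E U"
  obtain s where s: "s > 0" "\<forall>t>s. A \<subseteq> (*\<^sub>R) t ` U"
    using assms(1) U unfolding bounded_in_def by blast
  obtain r where r: "r > 0" "\<forall>t>r. B \<subseteq> (*\<^sub>R) t ` U"
    using assms(2) U unfolding bounded_in_def by blast
  have "\<forall>t>max s r. A \<union> B \<subseteq> (*\<^sub>R) t ` U"
    using s(2) r(2) by simp
  then show "\<exists>s>0. \<forall>t>s. A \<union> B \<subseteq> (*\<^sub>R) t ` U"
    using s(1) by (intro exI[of _ "max s r"]) auto
qed

lemma openin_strong_dual:
  "openin (strong_dual E) W \<longleftrightarrow> W \<subseteq> dual E \<and>
     (\<forall>\<phi>\<in>W. \<exists>B \<epsilon>. bounded_in E B \<and> \<epsilon> > 0 \<and>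
        {\<psi> \<in> dual E. \<forall>x\<in>B. \<bar>\<psi> x - \<phi> x\<bar> < \<epsilon>} \<subseteq> W)"
proof -
  define P where "P = (\<lambda>W. W \<subseteq> dual E \<and>
     (\<forall>\<phi>\<in>W. \<exists>B \<epsilon>. bounded_in E B \<and> \<epsilon> > 0 \<and>
        {\<psi> \<in> dual E. \<forall>x\<in>B. \<bar>\<psi> x - \<phi> x\<bar> < \<epsilon>} \<subseteq> W))"
  have "istopology P"
    unfolding istopology_def
  proof (intro conjI allI impI)
    fix S T assume ST: "P S" "P T"
    show "P (S \<inter> T)"
      unfolding P_def
    proof (intro conjI ballI)
      show "S \<inter> T \<subseteq> dual E" using ST by (auto simp: P_def)
      fix \<phi> assume \<phi>: "\<phi> \<in> S \<inter> T"
      obtain B \<epsilon> where B: "bounded_in E B" "\<epsilon> > 0"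
          "{\<psi> \<in> dual E. \<forall>x\<in>B. \<bar>\<psi> x - \<phi> x\<bar> < \<epsilon>} \<subseteq> S"
        using ST(1) \<phi> unfolding P_def by blast
      obtain C \<delta> where C: "bounded_in E C" "\<delta> > 0"
          "{\<psi> \<in> dual E. \<forall>x\<in>C. \<bar>\<psi> x - \<phi> x\<bar> < \<delta>} \<subseteq> T"
        using ST(2) \<phi> unfolding P_def by blast
      have "{\<psi> \<in> dual E. \<forall>x\<in>B \<union> C. \<bar>\<psi> x - \<phi> x\<bar> < min \<epsilon> \<delta>} \<subseteq> S \<inter> T"
        using B(3) C(3) by auto
      then show "\<exists>B \<epsilon>. bounded_in E B \<and> \<epsilon> > 0 \<and>
          {\<psi> \<in> dual E. \<forall>x\<in>B. \<bar>\<psi> x - \<phi> x\<bar> < \<epsilon>} \<subseteq> S \<inter> T"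
        using bounded_in_Un[OF B(1) C(1)] B(2) C(2)
        by (intro exI[of _ "B \<union> C"] exI[of _ "min \<epsilon> \<delta>"]) auto
    qed
  next
    fix \<K> assume "\<forall>K\<in>\<K>. P K"
    then show "P (\<Union>\<K>)"
      unfolding P_def by (auto; meson Sup_upper order_trans)
  qed
  then show ?thesis
    by (simp add: strong_dual_def P_def)
qed

lemma topspace_strong_dual [simp]: "topspace (strong_dual E) = dual E"
proof
  show "topspace (strong_dual E) \<subseteq> dual E"
    using openin_topspace[of "strong_dual E"] by (simp only: openin_strong_dual)
  have "openin (strong_dual E) (dual E)"
    unfolding openin_strong_dual using bounded_in_empty[of E] by (auto intro!: exI[of _ 1])
  then show "dual E \<subseteq> topspace (strong_dual E)"
    by (rule openin_subset)
qed

definition polar :: "'v::real_vector topology \<Rightarrow> 'v set \<Rightarrow> ('v \<Rightarrow> real) set" where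
  "polar E U = {\<phi> \<in> dual E. \<forall>x\<in>U. \<bar>\<phi> x\<bar> \<le> 1}"

definition equicontinuous :: "'v::real_vector topology \<Rightarrow> ('v \<Rightarrow> real) set \<Rightarrow> bool" where
  "equicontinuous E H \<longleftrightarrow> (\<exists>U. zero_neighbourhood E U \<and> H \<subseteq> polar E U)"

definition aleph0_quasibarrelled :: "'v::real_vector topology \<Rightarrow> bool" where
  "aleph0_quasibarrelled E \<longleftrightarrow>
     (\<forall>\<H>. countable \<H> \<and> (\<forall>H\<in>\<H>. equicontinuous E H) \<and> bounded_in (strong_dual E) (\<Union>\<H>)
        \<longrightarrow> equicontinuous E (\<Union>\<H>))"

definition linf_quasibarrelled :: "'v::real_vector topology \<Rightarrow> bool" where
  "linf_quasibarrelled E \<longleftrightarrow>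
     (\<forall>\<phi>::nat \<Rightarrow> 'v \<Rightarrow> real. bounded_in (strong_dual E) (range \<phi>) \<longrightarrow> equicontinuous E (range \<phi>))"

definition fundamental_bounded_sequence ::
    "'v::real_vector topology \<Rightarrow> (nat \<Rightarrow> 'v set) \<Rightarrow> bool" where
  "fundamental_bounded_sequence E B \<longleftrightarrow>
     incseq B \<and> (\<forall>n. bounded_in E (B n)) \<and> (\<forall>A. bounded_in E A \<longrightarrow> (\<exists>n. A \<subseteq> B n))"

definition DF_space :: "'v::real_vector topology \<Rightarrow> bool" where
  "DF_space E \<longleftrightarrow>
     lcs E \<and> (\<exists>B. fundamental_bounded_sequence E B) \<and> aleph0_quasibarrelled E"

definition almost_DF_space :: "'v::real_vector topology \<Rightarrow> bool" where
  "almost_DF_space E \<longleftrightarrow>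
     lcs E \<and> (\<exists>B. fundamental_bounded_sequence E B) \<and> linf_quasibarrelled E"


section \<open>The free locally convex space\<close>

text \<open>HOL cannot quantify over all types inside a formula, so in the universal property the test
  spaces \<open>E\<close> range over all locally convex spaces carried by linear subspaces of
  \<open>('x \<Rightarrow> real) \<times> 'v\<close>. This is no restriction: the ambient space contains linear copies of the
  span of \<open>f ` topspace X\<close>, for every \<open>f\<close>, and of \<open>L\<close> itself, and lemma \<open>free_lcs_universal\<close>
  below derives the universal property for locally convex spaces over an arbitrary type.\<close>

definition free_lcs ::
    "'x topology \<Rightarrow> 'v::real_vector topology \<Rightarrow> ('x \<Rightarrow> 'v) \<Rightarrow> bool" where
  "free_lcs X L i \<longleftrightarrow>
     lcs L \<and> continuous_map X L i \<and>
     (\<forall>(E :: (('x \<Rightarrow> real) \<times> 'v) topology) f. lcs E \<and> continuous_map X E f \<longrightarrow>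
        (\<exists>!g. g \<in> continuous_linear L E \<and> (\<forall>x\<in>topspace X. g (i x) = f x)))"

lemma lcs_subspace: "lcs E \<Longrightarrow> subspace (topspace E)"
  by (simp add: lcs_def)

lemma lcs_pullback:
  assumes E: "lcs E" and A: "subspace A" and lin: "linear_map_on A k"
    and inj: "inj_on k A" and sub: "k ` A \<subseteq> topspace E"
  shows "lcs (pullback_topology A k E)"
proof -
  let ?T = "pullback_topology A k E"
  have top: "topspace ?T = A"
    using sub by (auto simp: topspace_pullback_topology)
  have kc: "continuous_map ?T E k"
    using continuous_map_pullback[of E E id A k] by simp
  have into: "continuous_map Y ?T h"
    if "continuous_map Y E (k \<circ> h)" "h ` topspace Y \<subseteq> A" for Y :: "'c topology" and h
    using that by (intro continuous_map_pullback') auto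
  have add: "continuous_map (prod_topology ?T ?T) ?T (\<lambda>(x, y). x + y)"
  proof (rule into)
    have "continuous_map (prod_topology E E) E (\<lambda>(x, y). x + y)"
      using E by (simp add: lcs_def)
    then have "continuous_map (prod_topology ?T ?T) E
        ((\<lambda>(x, y). x + y) \<circ> (\<lambda>p. (k (fst p), k (snd p))))"
      by (intro continuous_map_compose[of _ "prod_topology E E"])
         (auto intro!: continuous_map_pairedI continuous_map_compose[OF continuous_map_fst kc, unfolded o_def]
            continuous_map_compose[OF continuous_map_snd kc, unfolded o_def])
    then show "continuous_map (prod_topology ?T ?T) E (k \<circ> (\<lambda>(x, y). x + y))"
      by (rule continuous_map_eq) (use lin in \<open>auto simp: top linear_map_on_def\<close>)
    show "(\<lambda>(x, y). x + y) ` topspace (prod_topology ?T ?T) \<subseteq> A"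
      using A by (auto simp: top subspace_add)
  qed
  have scale: "continuous_map (prod_topology euclideanreal ?T) ?T (\<lambda>(c, x). c *\<^sub>R x)"
  proof (rule into)
    have "continuous_map (prod_topology euclideanreal E) E (\<lambda>(c, x). c *\<^sub>R x)"
      using E by (simp add: lcs_def)
    then have "continuous_map (prod_topology euclideanreal ?T) E
        ((\<lambda>(c, x). c *\<^sub>R x) \<circ> (\<lambda>p. (fst p, k (snd p))))"
      by (intro continuous_map_compose[of _ "prod_topology euclideanreal E"])
         (auto intro!: continuous_map_pairedI continuous_map_fst
            continuous_map_compose[OF continuous_map_snd kc, unfolded o_def])
    then show "continuous_map (prod_topology euclideanreal ?T) E (k \<circ> (\<lambda>(c, x). c *\<^sub>R x))"
      by (rule continuous_map_eq) (use lin in \<open>auto simp: top linear_map_on_def\<close>)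
    show "(\<lambda>(c, x). c *\<^sub>R x) ` topspace (prod_topology euclideanreal ?T) \<subseteq> A"
      using A by (auto simp: top subspace_scale)
  qed
  have haus: "Hausdorff_space ?T"
    unfolding Hausdorff_space_def
  proof (intro allI impI)
    fix x y assume "x \<in> topspace ?T \<and> y \<in> topspace ?T \<and> x \<noteq> y"
    then have xy: "x \<in> A" "y \<in> A" "x \<noteq> y" by (auto simp: top)
    then have "k x \<in> topspace E" "k y \<in> topspace E" "k x \<noteq> k y"
      using inj sub by (auto simp: inj_on_def)
    then obtain U V where UV: "openin E U" "openin E V" "k x \<in> U" "k y \<in> V" "disjnt U V"
      using E unfolding lcs_def Hausdorff_space_def by meson
    show "\<exists>U V. openin ?T U \<and> openin ?T V \<and> x \<in> U \<and> y \<in> V \<and> disjnt U V"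
      using UV xy
      by (intro exI[of _ "k -` U \<inter> A"] exI[of _ "k -` V \<inter> A"])
         (auto simp: openin_pullback_topology disjnt_def)
  qed
  have base: "neighbourhood_base_of convex ?T"
    unfolding neighbourhood_base_of
  proof (intro allI impI)
    fix W x assume W: "openin ?T W \<and> x \<in> W"
    then obtain W' where W': "openin E W'" "W = k -` W' \<inter> A"
      by (auto simp: openin_pullback_topology)
    then obtain U C where UC: "openin E U" "convex C" "k x \<in> U" "U \<subseteq> C" "C \<subseteq> W'"
      using E W unfolding lcs_def neighbourhood_base_of by blast
    have "convex (k -` C \<inter> A)"
      unfolding convex_def
    proof (intro ballI allI impI)
      fix a b and u v :: real
      assume ab: "a \<in> k -` C \<inter> A" "b \<in> k -` C \<inter> A" and uv: "0 \<le> u" "0 \<le> v" "u + v = 1"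
      have "u *\<^sub>R a \<in> A" "v *\<^sub>R b \<in> A" using ab A by (auto simp: subspace_scale)
      then have "k (u *\<^sub>R a + v *\<^sub>R b) = u *\<^sub>R k a + v *\<^sub>R k b"
        using lin ab by (auto simp: linear_map_on_def)
      moreover have "u *\<^sub>R k a + v *\<^sub>R k b \<in> C"
        using ab uv UC(2) by (auto intro: convexD)
      ultimately show "u *\<^sub>R a + v *\<^sub>R b \<in> k -` C \<inter> A"
        using \<open>u *\<^sub>R a \<in> A\<close> \<open>v *\<^sub>R b \<in> A\<close> A by (auto simp: subspace_add)
    qed
    then show "\<exists>U V. openin ?T U \<and> convex V \<and> x \<in> U \<and> U \<subseteq> V \<and> V \<subseteq> W"
      using UC W W'
      by (intro exI[of _ "k -` U \<inter> A"] exI[of _ "k -` C \<inter> A"])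
         (auto simp: openin_pullback_topology)
  qed
  show ?thesis
    using A add scale haus base by (simp add: lcs_def top)
qed

lemma linear_map_on_sum:
  assumes lin: "linear_map_on V g" and V: "subspace V"
    and S: "finite S" "\<And>s. s \<in> S \<Longrightarrow> h s \<in> V"
  shows "g (\<Sum>s\<in>S. c s *\<^sub>R h s) = (\<Sum>s\<in>S. c s *\<^sub>R g (h s))"
  using S
proof (induction S rule: finite_induct)
  case empty
  have "g (0 *\<^sub>R 0) = 0 *\<^sub>R g 0"
    using lin subspace_0[OF V] unfolding linear_map_on_def by blast
  then show ?case by simp
next
  case (insert a S)
  have "(\<Sum>s\<in>S. c s *\<^sub>R h s) \<in> V"
    using insert by (intro subspace_sum[OF V] subspace_scale[OF V]) auto
  moreover have "h a \<in> V" using insert by simp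
  moreover have "c a *\<^sub>R h a \<in> V" by (rule subspace_scale[OF V]) fact
  ultimately have "g (c a *\<^sub>R h a + (\<Sum>s\<in>S. c s *\<^sub>R h s)) = c a *\<^sub>R g (h a) + g (\<Sum>s\<in>S. c s *\<^sub>R h s)"
    using lin unfolding linear_map_on_def by simp
  then show ?case using insert by simp
qed

lemma linear_map_on_eq_span:
  assumes g: "linear_map_on V g" and h: "linear_map_on V h" and V: "subspace V" "S \<subseteq> V"
    and eq: "\<And>s. s \<in> S \<Longrightarrow> g s = h s" and x: "x \<in> span S"
  shows "g x = h x"
proof -
  obtain T c where T: "finite T" "T \<subseteq> S" "x = (\<Sum>s\<in>T. c s *\<^sub>R s)"
    using x unfolding span_explicit by auto
  have TV: "\<And>s. s \<in> T \<Longrightarrow> s \<in> V" using T V by auto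
  have "g x = (\<Sum>s\<in>T. c s *\<^sub>R g s)"
    unfolding T(3) by (rule linear_map_on_sum[OF g V(1) T(1) TV])
  also have "\<dots> = (\<Sum>s\<in>T. c s *\<^sub>R h s)"
    using T eq by (intro sum.cong) auto
  also have "\<dots> = h x"
    unfolding T(3) by (rule linear_map_on_sum[OF h V(1) T(1) TV, symmetric])
  finally show ?thesis .
qed

lemma continuous_map_into_pullback:
  assumes "continuous_map Y E (k \<circ> h)" "h ` topspace Y \<subseteq> A"
  shows "continuous_map Y (pullback_topology A k E) h"
  using assms by (intro continuous_map_pullback') auto

lemma continuous_map_from_pullback: "continuous_map (pullback_topology A k E) E k"
  using continuous_map_pullback[of E E id A k] by simp

lemma free_lcs_span:
  fixes X :: "'x topology" and L :: "'v::real_vector topology"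
  assumes free: "free_lcs X L i"
  shows "topspace L = span (i ` topspace X)"
proof
  have L: "lcs L" and ci: "continuous_map X L i" using free by (auto simp: free_lcs_def)
  note V = lcs_subspace[OF L]
  have iX: "i ` topspace X \<subseteq> topspace L"
    using ci by (auto simp: continuous_map_def)
  show sub: "span (i ` topspace X) \<subseteq> topspace L"
    using iX V by (rule span_minimal)
  define emb :: "'v \<Rightarrow> ('x \<Rightarrow> real) \<times> 'v" where "emb = (\<lambda>v. (0, v))"
  have lin_emb: "linear emb" by (rule linearI) (auto simp: emb_def)
  have test: "lcs (pullback_topology (emb ` S) snd L)" if "subspace S" "S \<subseteq> topspace L" for S
    using that
    by (intro lcs_pullback[OF L] linear_subspace_image[OF lin_emb])
       (auto simp: linear_map_on_def emb_def inj_on_def)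
  define T where "T = (\<lambda>S. pullback_topology (emb ` S) snd L)"
  define M where "M = span (i ` topspace X)"
  have M: "subspace M" "M \<subseteq> topspace L" using sub by (auto simp: M_def)
  have topT: "topspace (T S) = emb ` S" if "S \<subseteq> topspace L" for S
    using that by (auto simp: T_def topspace_pullback_topology emb_def)
  have cX: "continuous_map X (T S) (emb \<circ> i)" if "i ` topspace X \<subseteq> S" for S
    unfolding T_def
    by (rule continuous_map_into_pullback) (use ci that in \<open>auto simp: o_def emb_def\<close>)
  have iM: "i ` topspace X \<subseteq> M" by (auto simp: M_def span_base)
  obtain g where g: "g \<in> continuous_linear L (T M)" "\<forall>x\<in>topspace X. g (i x) = (emb \<circ> i) x"
    using free test[OF M] cX[OF iM] unfolding free_lcs_def T_def by blast
  have gM: "g v \<in> emb ` M" if "v \<in> topspace L" for v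
    using g(1) that topT[OF M(2)] by (auto simp: continuous_linear_def continuous_map_def)
  define id' where "id' = (\<lambda>v. if v \<in> topspace L then emb v else 0)"
  have "id' \<in> continuous_linear L (T (topspace L))"
    unfolding continuous_linear_def mem_Collect_eq
  proof (intro conjI allI impI)
    show "linear_map_on (topspace L) id'"
      using V by (auto simp: linear_map_on_def id'_def emb_def subspace_add subspace_scale)
    show "continuous_map L (T (topspace L)) id'"
      unfolding T_def
    proof (rule continuous_map_into_pullback)
      show "continuous_map L L (snd \<circ> id')"
        by (rule continuous_map_eq[OF continuous_map_id]) (auto simp: id'_def emb_def)
    qed (auto simp: id'_def)
  qed (simp add: id'_def)
  moreover have "\<forall>x\<in>topspace X. id' (i x) = (emb \<circ> i) x"
    using iX by (auto simp: id'_def)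
  moreover have "g \<in> continuous_linear L (T (topspace L))"
    unfolding continuous_linear_def mem_Collect_eq
  proof (intro conjI)
    show "linear_map_on (topspace L) g" "\<forall>x. x \<notin> topspace L \<longrightarrow> g x = 0"
      using g(1) by (auto simp: continuous_linear_def)
    show "continuous_map L (T (topspace L)) g"
      unfolding T_def
    proof (rule continuous_map_into_pullback)
      have "continuous_map L (T M) g" using g(1) by (simp add: continuous_linear_def)
      then show "continuous_map L L (snd \<circ> g)"
        unfolding T_def by (rule continuous_map_compose[OF _ continuous_map_from_pullback])
      show "g ` topspace L \<subseteq> emb ` topspace L"
        using gM M(2) by blast
    qed
  qed
  moreover have "lcs (T (topspace L))" "continuous_map X (T (topspace L)) (emb \<circ> i)"
    using test[OF V] cX[OF iX] by (auto simp: T_def)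
  ultimately have "id' = g"
    using free g(2) unfolding free_lcs_def by blast
  show "topspace L \<subseteq> span (i ` topspace X)"
  proof
    fix v assume v: "v \<in> topspace L"
    have "emb v \<in> emb ` M" using gM[OF v] \<open>id' = g\<close> v by (auto simp: id'_def)
    then show "v \<in> span (i ` topspace X)" by (auto simp: emb_def M_def)
  qed
qed

lemma free_lcs_universal:
  fixes X :: "'x topology" and L :: "'v::real_vector topology" and E :: "'e::real_vector topology"
  assumes free: "free_lcs X L i" and E: "lcs E" and f: "continuous_map X E f"
  shows "\<exists>!g. g \<in> continuous_linear L E \<and> (\<forall>x\<in>topspace X. g (i x) = f x)"
proof (rule ex_ex1I)
  have L: "lcs L" and ci: "continuous_map X L i" using free by (auto simp: free_lcs_def)
  have iX: "i ` topspace X \<subseteq> topspace L"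
    using ci by (auto simp: continuous_map_def)
  have fX: "f ` topspace X \<subseteq> topspace E"
    using f by (auto simp: continuous_map_def)
  show "g = g'" if g: "g \<in> continuous_linear L E \<and> (\<forall>x\<in>topspace X. g (i x) = f x)"
    and g': "g' \<in> continuous_linear L E \<and> (\<forall>x\<in>topspace X. g' (i x) = f x)" for g g'
  proof
    fix v
    show "g v = g' v"
    proof (cases "v \<in> topspace L")
      case True
      have lin: "linear_map_on (topspace L) g" "linear_map_on (topspace L) g'"
        using g g' by (auto simp: continuous_linear_def)
      show ?thesis
        by (rule linear_map_on_eq_span[OF lin lcs_subspace[OF L] iX])
           (use g g' True free_lcs_span[OF free] in auto)
    qed (use g g' in \<open>auto simp: continuous_linear_def\<close>)
  qed
  define S where "S = span (f ` topspace X)"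
  have SE: "S \<subseteq> topspace E"
    unfolding S_def using fX lcs_subspace[OF E] by (rule span_minimal)
  obtain B where B: "B \<subseteq> f ` topspace X" "independent B" "f ` topspace X \<subseteq> span B"
    using maximal_independent_subset[of "f ` topspace X"] by blast
  have SB: "S = span B"
    unfolding S_def using B by (metis span_mono span_span subset_antisym)
  define r where "r = inv_into (topspace X) f"
  have r: "f (r b) = b" if "b \<in> B" for b
    unfolding r_def using that B(1) by (auto intro: f_inv_into_f)
  define h :: "'e \<Rightarrow> ('x \<Rightarrow> real) \<times> 'v" where
    "h = (\<lambda>v. ((\<lambda>x. if x \<in> r ` B then representation B v (f x) else 0), 0))"
  have h_lin: "h (u + v) = h u + h v" "h (c *\<^sub>R u) = c *\<^sub>R h u" if "u \<in> S" "v \<in> S" for u v c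
    using that B(2) by (auto simp: h_def SB representation_add representation_scale fun_eq_iff)
  have h_inj: "inj_on h S"
  proof (rule inj_onI)
    fix u v assume uv: "u \<in> S" "v \<in> S" "h u = h v"
    have "representation B u b = representation B v b" for b
    proof (cases "b \<in> B")
      case True
      then show ?thesis
        using fun_cong[OF arg_cong[OF uv(3), of fst], of "r b"] r[OF True] by (simp add: h_def)
    next
      case False
      then show ?thesis using representation_ne_zero by metis
    qed
    then have "representation B u = representation B v" by blast
    then show "u = v"
      using sum_nonzero_representation_eq[OF B(2)] uv SB by metis
  qed
  define k where "k = inv_into S h"
  have kh: "k (h v) = v" if "v \<in> S" for v
    unfolding k_def using h_inj that by simp
  have S: "subspace S" by (simp add: S_def)
  have hS: "subspace (h ` S)"
    unfolding subspace_def
  proof (intro conjI ballI allI)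
    have "h (0 *\<^sub>R 0) = 0 *\<^sub>R h 0" using h_lin(2)[of 0 0] subspace_0[OF S] by blast
    then show "0 \<in> h ` S" using subspace_0[OF S] by (auto intro!: image_eqI[of _ _ 0])
    show "x + y \<in> h ` S" if "x \<in> h ` S" "y \<in> h ` S" for x y
      using that by (auto simp flip: h_lin(1) intro: subspace_add[OF S])
    show "c *\<^sub>R x \<in> h ` S" if "x \<in> h ` S" for c x
      using that by (auto simp flip: h_lin(2) intro: subspace_scale[OF S])
  qed
  have k_lin: "linear_map_on (h ` S) k"
    by (auto simp: linear_map_on_def kh subspace_add[OF S] subspace_scale[OF S]
          simp flip: h_lin)
  define T where "T = pullback_topology (h ` S) k E"
  have T: "lcs T"
    unfolding T_def
    by (rule lcs_pullback[OF E hS k_lin]) (use SE kh in \<open>auto simp: inj_on_def\<close>)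
  have fS: "f x \<in> S" if "x \<in> topspace X" for x
    using that by (simp add: S_def span_base)
  have "continuous_map X T (h \<circ> f)"
    unfolding T_def
  proof (rule continuous_map_into_pullback)
    show "continuous_map X E (k \<circ> (h \<circ> f))"
      using f by (rule continuous_map_eq) (simp add: kh fS)
  qed (auto simp: fS)
  then obtain g where g: "g \<in> continuous_linear L T" "\<forall>x\<in>topspace X. g (i x) = (h \<circ> f) x"
    using free T unfolding free_lcs_def by blast
  have gS: "g v \<in> h ` S" if "v \<in> topspace L" for v
    using g(1) that
    by (auto simp: continuous_linear_def continuous_map_def T_def topspace_pullback_topology)
  define g' where "g' = (\<lambda>v. if v \<in> topspace L then k (g v) else 0)"
  have "linear_map_on (topspace L) g'"
  proof -
    have "linear_map_on (topspace L) g" using g(1) by (simp add: continuous_linear_def)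
    then show ?thesis
      using k_lin gS lcs_subspace[OF L]
      unfolding linear_map_on_def g'_def by (simp add: subspace_add subspace_scale del: ball_simps)
  qed
  moreover have "continuous_map L E g'"
  proof -
    have "continuous_map L E (k \<circ> g)"
      using g(1) unfolding continuous_linear_def T_def
      by (auto intro: continuous_map_compose[OF _ continuous_map_from_pullback])
    then show ?thesis by (rule continuous_map_eq) (simp add: g'_def)
  qed
  moreover have "\<forall>x\<in>topspace X. g' (i x) = f x"
    using g(2) iX fS by (auto simp: g'_def kh)
  ultimately show "\<exists>g. g \<in> continuous_linear L E \<and> (\<forall>x\<in>topspace X. g (i x) = f x)"
    by (intro exI[of _ g']) (auto simp: continuous_linear_def g'_def)
qed

end

theory Submission
  imports Defs
begin

text \<open>By the universal property the dual of \<open>L(X)\<close> is the space of continuous real functions on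
  \<open>X\<close>. The implication from (DF) to almost (DF) is general: a sequence in the dual is a countable
  union of singletons, and singletons are equicontinuous.

  Suppose that \<open>L(X)\<close> is almost (DF). A uniformly bounded sequence of continuous functions on
  \<open>X\<close> is strongly bounded in the dual (\<open>uniformly_bounded_imp_strongly_bounded\<close>). This is a
  Banach-Steinhaus argument: on a bounded subset of \<open>L(X)\<close>, the functional given by a series of
  terms of the sequence with coefficients \<open>\<plusminus> 3\<^sup>-\<^sup>k\<close> is bounded, because the series converges to a
  continuous function; a gliding hump (\<open>uniform_boundedness\<close>) turns the bounds for all these series
  into one bound for all terms. Such a sequence is therefore equicontinuous. Apply this to
  functions \<open>f\<^sub>n\<close> that vanish at \<open>x\<close> and equal 1 off a neighbourhood \<open>U\<^sub>n\<close> of \<open>x\<close>: a common neighbourhood of \<open>x\<close> on which all of them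
  are below 1 lies in every \<open>U\<^sub>n\<close>. Hence countable intersections of open subsets of \<open>X\<close> are
  open, that is, \<open>X\<close> is a P-space (\<open>linf_quasibarrelled_imp_P_space\<close>).

  In a Tychonoff P-space every function on a countable subset extends continuously
  (\<open>P_space_extend_from_countable\<close>). If a set of elements of \<open>L(X)\<close> had infinitely many points of
  \<open>X\<close> in its supports, an \<open>\<ell>\<^sub>\<infinity>\<close>-valued function growing fast enough along some of these points
  would be unbounded on it; so bounded subsets of \<open>L(X)\<close> are supported by finite sets
  (\<open>P_space_bounded_finite_dimensional\<close>). A fundamental bounded sequence then exhausts \<open>X\<close> by
  countably many finite sets, and a countable Hausdorff P-space is discrete.

  Conversely, let \<open>X\<close> be countable and discrete. Then \<open>X\<close> is a P-space, so bounded sets are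
  finite-dimensional again, and the boxes of coefficients at most \<open>n\<close> on the first points of \<open>X\<close>
  form a fundamental bounded sequence. Every map from \<open>X\<close> to a locally convex space extends to a
  continuous operator, which gives enough continuous seminorms on \<open>L(X)\<close> to make every pointwise
  bounded set of functionals equicontinuous
  (\<open>countable_discrete_pointwise_bounded_equicontinuous\<close>).\<close>

section \<open>Locally convex spaces\<close>

lemma lcs_euclidean: "lcs (euclidean :: 'a::real_normed_vector topology)"
  unfolding lcs_def
proof (intro conjI)
  show "continuous_map (prod_topology euclidean euclidean) (euclidean :: 'a topology) (\<lambda>(x, y). x + y)"
    by (simp add: euclidean_product_topology case_prod_beta) (intro continuous_intros)
  show "continuous_map (prod_topology euclideanreal euclidean) (euclidean :: 'a topology) (\<lambda>(c, x). c *\<^sub>R x)"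
    by (simp add: euclidean_product_topology case_prod_beta) (intro continuous_intros)
  show "Hausdorff_space (euclidean :: 'a topology)" by simp
  show "neighbourhood_base_of convex (euclidean :: 'a topology)"
    unfolding neighbourhood_base_of
  proof (intro allI impI)
    fix W :: "'a set" and x assume "openin euclidean W \<and> x \<in> W"
    then obtain e where "e > 0" "ball x e \<subseteq> W"
      by (auto simp: open_contains_ball)
    then show "\<exists>U V. openin euclidean U \<and> convex V \<and> x \<in> U \<and> U \<subseteq> V \<and> V \<subseteq> W"
      by (intro exI[of _ "ball x e"]) auto
  qed
qed auto

lemma lcs_continuous_map_add:
  assumes "lcs E" "continuous_map X E f" "continuous_map X E g"
  shows "continuous_map X E (\<lambda>x. f x + g x)"
proof -
  have "continuous_map X E ((\<lambda>(x, y). x + y) \<circ> (\<lambda>x. (f x, g x)))"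
    using assms by (intro continuous_map_compose[of _ "prod_topology E E"])
      (auto simp: lcs_def intro: continuous_map_pairedI)
  then show ?thesis by (simp add: o_def)
qed

lemma lcs_continuous_map_scaleR:
  assumes "lcs E" "continuous_map X euclideanreal f" "continuous_map X E g"
  shows "continuous_map X E (\<lambda>x. f x *\<^sub>R g x)"
proof -
  have "continuous_map X E ((\<lambda>(c, x). c *\<^sub>R x) \<circ> (\<lambda>x. (f x, g x)))"
    using assms by (intro continuous_map_compose[of _ "prod_topology euclideanreal E"])
      (auto simp: lcs_def intro: continuous_map_pairedI)
  then show ?thesis by (simp add: o_def)
qed

lemma continuous_linear_scaleR:
  "g \<in> continuous_linear E F \<Longrightarrow> v \<in> topspace E \<Longrightarrow> g (c *\<^sub>R v) = c *\<^sub>R g v"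
  by (simp add: continuous_linear_def linear_map_on_def)

lemma continuous_linear_add:
  "g \<in> continuous_linear E F \<Longrightarrow> v \<in> topspace E \<Longrightarrow> w \<in> topspace E \<Longrightarrow> g (v + w) = g v + g w"
  by (simp add: continuous_linear_def linear_map_on_def)

lemma continuous_linear_zero_neighbourhood:
  fixes g :: "'v::real_vector \<Rightarrow> 'a::real_normed_vector"
  assumes E: "lcs E" and g: "g \<in> continuous_linear E euclidean" and "e > 0"
  shows "zero_neighbourhood E {v \<in> topspace E. norm (g v) < e}"
proof -
  have 0: "0 \<in> topspace E" using E by (simp add: lcs_def subspace_0)
  then have "g 0 = 0" using continuous_linear_scaleR[OF g, of 0 0] by simp
  moreover have "openin E {v \<in> topspace E. g v \<in> ball 0 e}"
    using g by (intro openin_continuous_map_preimage) (auto simp: continuous_linear_def)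
  then have "openin E {v \<in> topspace E. norm (g v) < e}" by simp
  ultimately show ?thesis
    unfolding zero_neighbourhood_def using 0 \<open>e > 0\<close> by (auto intro!: exI[of _ "{v \<in> topspace E. norm (g v) < e}"])
qed

lemma bounded_in_absorb:
  assumes "bounded_in E A" "zero_neighbourhood E U"
  obtains s where "s > 0" "\<And>a. a \<in> A \<Longrightarrow> \<exists>v\<in>U. a = s *\<^sub>R v"
proof -
  have "\<exists>s>0. \<forall>t>s. A \<subseteq> (*\<^sub>R) t ` U" using assms by (simp add: bounded_in_def)
  then obtain s where s: "s > 0" "\<forall>t>s. A \<subseteq> (*\<^sub>R) t ` U" by (elim exE conjE)
  then have "A \<subseteq> (*\<^sub>R) (s + 1) ` U" by simp
  then have "\<exists>v\<in>U. a = (s + 1) *\<^sub>R v" if "a \<in> A" for a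
    using subsetD[OF \<open>A \<subseteq> (*\<^sub>R) (s + 1) ` U\<close> that] by (simp add: image_iff)
  then show ?thesis using s(1) by (intro that[of "s + 1"]) auto
qed

lemma bounded_in_continuous_linear:
  fixes g :: "'v::real_vector \<Rightarrow> 'a::real_normed_vector"
  assumes E: "lcs E" and g: "g \<in> continuous_linear E euclidean" and A: "bounded_in E A"
  shows "\<exists>M. \<forall>a\<in>A. norm (g a) \<le> M"
proof -
  obtain s where s: "s > 0"
    "\<And>a. a \<in> A \<Longrightarrow> \<exists>v\<in>{v \<in> topspace E. norm (g v) < 1}. a = s *\<^sub>R v"
    using bounded_in_absorb[OF A continuous_linear_zero_neighbourhood[OF E g zero_less_one]] by metis
  have "norm (g a) \<le> s" if a: "a \<in> A" for a
  proof -
    obtain v where v: "v \<in> topspace E" "norm (g v) < 1" "a = s *\<^sub>R v"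
      using s(2)[OF a] by auto
    have "norm (g a) = s * norm (g v)"
      using v s(1) continuous_linear_scaleR[OF g] by simp
    also have "\<dots> \<le> s * 1" using v s(1) by (intro mult_left_mono) auto
    finally show ?thesis by simp
  qed
  then show ?thesis by blast
qed

lemma bounded_in_subset: "bounded_in E B \<Longrightarrow> A \<subseteq> B \<Longrightarrow> bounded_in E A"
  unfolding bounded_in_def by (meson subset_trans)

text \<open>Only convexity of the neighbourhoods is used. With \<open>N = card F\<close>, a combination divided by \<open>t\<close> is
  the average over \<open>x\<close> of the multiples of \<open>e x\<close> by \<open>N * c x / t\<close>, and these factors are small
  for large \<open>t\<close>.\<close>

lemma bounded_in_box:
  fixes e :: "'x \<Rightarrow> 'v::real_vector"
  assumes E: "lcs E" and F: "finite F" "e ` F \<subseteq> topspace E"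
  shows "bounded_in E {\<Sum>x\<in>F. c x *\<^sub>R e x |c. \<forall>x\<in>F. \<bar>c x\<bar> \<le> m}" (is "bounded_in E ?B")
  unfolding bounded_in_def
proof (intro conjI allI impI)
  have V: "subspace (topspace E)" using E by (rule lcs_subspace)
  show "?B \<subseteq> topspace E"
    using F by (auto intro!: subspace_sum[OF V] subspace_scale[OF V])
  fix U assume "zero_neighbourhood E U"
  then obtain V0 where V0: "openin E V0" "0 \<in> V0" "V0 \<subseteq> U" "U \<subseteq> topspace E"
    by (auto simp: zero_neighbourhood_def)
  then obtain V C where C: "openin E V" "convex C" "0 \<in> V" "V \<subseteq> C" "C \<subseteq> V0"
    using E unfolding lcs_def neighbourhood_base_of by blast
  have "\<exists>d>0. \<forall>r. \<bar>r\<bar> < d \<longrightarrow> r *\<^sub>R e x \<in> V" if x: "x \<in> F" for x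
  proof -
    have "continuous_map euclideanreal E (\<lambda>r. r *\<^sub>R e x)"
      using x F by (intro lcs_continuous_map_scaleR[OF E]) auto
    then have "open {r. r *\<^sub>R e x \<in> V}"
      using openin_continuous_map_preimage[of euclideanreal E "\<lambda>r. r *\<^sub>R e x" V] C(1) by simp
    moreover have "0 \<in> {r. r *\<^sub>R e x \<in> V}" using C by simp
    ultimately obtain d where "d > 0" "ball 0 d \<subseteq> {r. r *\<^sub>R e x \<in> V}"
      by (meson open_contains_ball)
    then show ?thesis by (intro exI[of _ d]) (auto simp: subset_iff)
  qed
  then obtain d where d: "\<And>x. x \<in> F \<Longrightarrow> d x > 0" "\<And>x r. x \<in> F \<Longrightarrow> \<bar>r\<bar> < d x \<Longrightarrow> r *\<^sub>R e x \<in> V"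
    by metis
  define \<delta> where "\<delta> = Min (insert 1 (d ` F))"
  have \<delta>: "\<delta> > 0" "\<And>x. x \<in> F \<Longrightarrow> \<delta> \<le> d x"
    using F d by (auto simp: \<delta>_def)
  define s where "s = real (card F) * (\<bar>m\<bar> + 1) / \<delta> + 1"
  have s: "s > 0" using \<delta> by (auto simp: s_def intro!: add_nonneg_pos)
  have "v \<in> (*\<^sub>R) t ` U" if t: "t > s" and v: "v \<in> ?B" for t v
  proof -
    obtain c where c: "v = (\<Sum>x\<in>F. c x *\<^sub>R e x)" "\<forall>x\<in>F. \<bar>c x\<bar> \<le> m" using v by blast
    have t0: "t > 0" using s t by simp
    define u where "u = (\<Sum>x\<in>F. (c x / t) *\<^sub>R e x)"
    have "u \<in> C"
    proof (cases "F = {}")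
      case True then show ?thesis using C by (auto simp: u_def)
    next
      case False
      define N where "N = real (card F)"
      have N: "N > 0" using False F by (simp add: N_def card_gt_0_iff)
      have "u = (\<Sum>x\<in>F. (1 / N) *\<^sub>R ((N * c x / t) *\<^sub>R e x))"
        using N by (simp add: u_def)
      also have "\<dots> \<in> C"
      proof (rule convex_sum[OF F(1) C(2)])
        show "(\<Sum>x\<in>F. 1 / N) = 1" using N by (simp add: N_def)
        fix x assume x: "x \<in> F"
        have "N * (\<bar>m\<bar> + 1) / \<delta> < t" using t by (simp add: s_def N_def)
        then have "N * (\<bar>m\<bar> + 1) < \<delta> * t" using \<delta> by (simp add: field_simps)
        moreover have "N * \<bar>c x\<bar> \<le> N * (\<bar>m\<bar> + 1)" using c x N by (intro mult_left_mono) force+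
        ultimately have "N * \<bar>c x\<bar> / t < \<delta>" using t0 by (simp add: field_simps)
        then have "\<bar>N * c x / t\<bar> < d x" using \<delta>(2)[OF x] N t0 by (simp add: abs_mult)
        then show "(N * c x / t) *\<^sub>R e x \<in> C" using d(2)[OF x] C by blast
      qed (use N in auto)
      finally show ?thesis .
    qed
    moreover have "v = t *\<^sub>R u" using t0 by (simp add: u_def c scaleR_sum_right)
    ultimately show ?thesis using C V0 by blast
  qed
  then show "\<exists>s>0. \<forall>t>s. ?B \<subseteq> (*\<^sub>R) t ` U" using s by blast
qed

lemma bounded_in_singleton:
  assumes "lcs E" "v \<in> topspace E"
  shows "bounded_in E {v}"
proof -
  have "bounded_in E {\<Sum>x\<in>{v}. c x *\<^sub>R x |c. \<forall>x\<in>{v}. \<bar>c x\<bar> \<le> 1}"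
    using assms by (intro bounded_in_box) auto
  moreover have "v \<in> {\<Sum>x\<in>{v}. c x *\<^sub>R x |c. \<forall>x\<in>{v}. \<bar>c x\<bar> \<le> 1}"
    by (auto intro!: exI[of _ "\<lambda>_. 1"])
  ultimately show ?thesis by (meson bounded_in_subset empty_subsetI insert_subset)
qed

lemma dual_scaleR: "\<phi> \<in> dual E \<Longrightarrow> c *\<^sub>R \<phi> \<in> dual E"
  unfolding dual_def continuous_linear_def linear_map_on_def
  by (auto simp: distrib_left scaleR_fun_def continuous_map_real_mult_left)

lemma bounded_in_strong_dualI:
  assumes E: "lcs E" and H: "H \<subseteq> dual E"
    and bd: "\<And>B. bounded_in E B \<Longrightarrow> \<exists>M. \<forall>\<phi>\<in>H. \<forall>x\<in>B. \<bar>\<phi> x\<bar> \<le> M"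
  shows "bounded_in (strong_dual E) H"
  unfolding bounded_in_def
proof (intro conjI allI impI)
  show "H \<subseteq> topspace (strong_dual E)" using H by simp
  fix U assume "zero_neighbourhood (strong_dual E) U"
  then obtain W where W: "openin (strong_dual E) W" "0 \<in> W" "W \<subseteq> U"
    by (auto simp: zero_neighbourhood_def)
  then obtain B \<epsilon> where B: "bounded_in E B" "\<epsilon> > 0"
      "{\<psi> \<in> dual E. \<forall>x\<in>B. \<bar>\<psi> x - 0 x\<bar> < \<epsilon>} \<subseteq> W"
    unfolding openin_strong_dual by blast
  obtain M where M: "\<forall>\<phi>\<in>H. \<forall>x\<in>B. \<bar>\<phi> x\<bar> \<le> M" using bd[OF B(1)] by blast
  define s where "s = \<bar>M\<bar> / \<epsilon> + 1"
  have s: "s > 0" using B by (auto simp: s_def intro!: add_nonneg_pos)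
  have "\<phi> \<in> (*\<^sub>R) t ` U" if t: "t > s" and \<phi>: "\<phi> \<in> H" for t \<phi>
  proof -
    have t0: "t > 0" using t s by simp
    have "\<bar>M\<bar> / \<epsilon> < t" using t by (simp add: s_def)
    then have Mt: "\<bar>M\<bar> < t * \<epsilon>" using B by (simp add: field_simps)
    have "\<bar>((1 / t) *\<^sub>R \<phi>) x - 0 x\<bar> < \<epsilon>" if "x \<in> B" for x
    proof -
      have "\<bar>\<phi> x\<bar> \<le> M" using M \<phi> that by blast
      then have "\<bar>\<phi> x\<bar> < t * \<epsilon>" using Mt by simp
      then show ?thesis using t0 by (simp add: field_simps abs_mult)
    qed
    moreover have "(1 / t) *\<^sub>R \<phi> \<in> dual E" using \<phi> H by (auto intro: dual_scaleR)
    ultimately have "(1 / t) *\<^sub>R \<phi> \<in> U" using B(3) W(3) by blast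
    moreover have "\<phi> = t *\<^sub>R (1 / t) *\<^sub>R \<phi>" using t0 by simp
    ultimately show ?thesis by blast
  qed
  then show "\<exists>s>0. \<forall>t>s. H \<subseteq> (*\<^sub>R) t ` U" using s by blast
qed

lemma bounded_in_strong_dual_pointwise:
  assumes E: "lcs E" and H: "bounded_in (strong_dual E) H" and v: "v \<in> topspace E"
  shows "\<exists>M. \<forall>\<phi>\<in>H. \<bar>\<phi> v\<bar> \<le> M"
proof -
  define W where "W = {\<psi> \<in> dual E. \<bar>\<psi> v\<bar> < 1}"
  have 0: "0 \<in> dual E"
    by (auto simp: dual_def continuous_linear_def linear_map_on_def zero_fun_def)
  have "\<exists>B \<epsilon>. bounded_in E B \<and> \<epsilon> > 0 \<and> {\<psi> \<in> dual E. \<forall>x\<in>B. \<bar>\<psi> x - \<phi> x\<bar> < \<epsilon>} \<subseteq> W"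
    if "\<phi> \<in> W" for \<phi>
    using that bounded_in_singleton[OF E v]
    by (intro exI[of _ "{v}"] exI[of _ "1 - \<bar>\<phi> v\<bar>"]) (auto simp: W_def)
  then have "openin (strong_dual E) W" unfolding openin_strong_dual by (auto simp: W_def)
  then have "zero_neighbourhood (strong_dual E) W"
    unfolding zero_neighbourhood_def using 0 by (auto simp: W_def)
  from bounded_in_absorb[OF H this]
  obtain s where s: "s > 0" "\<And>\<phi>. \<phi> \<in> H \<Longrightarrow> \<exists>\<psi>\<in>W. \<phi> = s *\<^sub>R \<psi>" by metis
  have "\<bar>\<phi> v\<bar> \<le> s" if \<phi>: "\<phi> \<in> H" for \<phi>
  proof -
    obtain \<psi> where \<psi>: "\<psi> \<in> W" "\<phi> = s *\<^sub>R \<psi>" using s(2)[OF \<phi>] by auto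
    then have "s * \<bar>\<psi> v\<bar> \<le> s * 1"
      using s by (intro mult_left_mono) (auto simp: W_def)
    then show ?thesis using s \<psi> by (simp add: abs_mult)
  qed
  then show ?thesis by blast
qed

lemma dual_equicontinuous_singleton:
  assumes E: "lcs E" and \<phi>: "\<phi> \<in> dual E"
  shows "equicontinuous E {\<phi>}"
  unfolding equicontinuous_def
proof (intro exI conjI)
  show "zero_neighbourhood E {v \<in> topspace E. norm (\<phi> v) < 1}"
    using \<phi> by (intro continuous_linear_zero_neighbourhood[OF E]) (auto simp: dual_def)
  show "{\<phi>} \<subseteq> polar E {v \<in> topspace E. norm (\<phi> v) < 1}"
    using \<phi> by (auto simp: polar_def)
qed

lemma DF_imp_almost_DF:
  assumes "DF_space E"
  shows "almost_DF_space E"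
proof -
  have E: "lcs E" and q: "aleph0_quasibarrelled E" using assms by (auto simp: DF_space_def)
  have "equicontinuous E (range \<phi>)" if b: "bounded_in (strong_dual E) (range \<phi>)"
    for \<phi> :: "nat \<Rightarrow> 'a \<Rightarrow> real"
  proof -
    let ?H = "range (\<lambda>n. {\<phi> n})"
    have un: "\<Union>?H = range \<phi>" by auto
    have "\<phi> n \<in> dual E" for n using b by (auto simp: bounded_in_def)
    then have "\<forall>H\<in>?H. equicontinuous E H" by (auto intro: dual_equicontinuous_singleton[OF E])
    then have "equicontinuous E (\<Union>?H)"
      using q b un unfolding aleph0_quasibarrelled_def by (metis countable_image countableI_type)
    then show ?thesis by (simp only: un)
  qed
  then show ?thesis using assms by (simp add: almost_DF_space_def DF_space_def linf_quasibarrelled_def)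
qed

lemma span_image_finite_sum:
  assumes "v \<in> span (e ` F)"
  obtains T c where "finite T" "T \<subseteq> F" "v = (\<Sum>x\<in>T. c x *\<^sub>R e x)"
proof -
  obtain S c where S: "finite S" "S \<subseteq> e ` F" "v = (\<Sum>s\<in>S. c s *\<^sub>R s)"
    using assms unfolding span_explicit by auto
  then obtain T where T: "T \<subseteq> F" "inj_on e T" "S = e ` T" by (meson subset_image_inj)
  show ?thesis
  proof
    show "finite T" using S T finite_imageD by blast
    show "v = (\<Sum>x\<in>T. (c \<circ> e) x *\<^sub>R e x)" using S(3) T by (simp add: sum.reindex)
  qed fact
qed

section \<open>A uniform boundedness principle\<close>

text \<open>Choose the signs one after the other so that the term of index \<open>k\<close> never cancels the
  contribution of the earlier ones to row \<open>k\<close>.\<close>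

lemma sign_sequence:
  fixes q :: "nat \<Rightarrow> nat \<Rightarrow> real"
  obtains s :: "nat \<Rightarrow> real" where "\<And>k. \<bar>s k\<bar> = 1" "\<And>k. (\<Sum>j<k. s j * q k j) * (s k * q k k) \<ge> 0"
proof -
  have "\<exists>s::nat \<Rightarrow> real. \<forall>k. \<bar>s k\<bar> = 1 \<and> (\<Sum>j<k. s j * q k j) * (s k * q k k) \<ge> 0"
  proof (rule dependent_wellorder_choice)
    fix r :: real and f g :: "nat \<Rightarrow> real" and k :: nat
    assume "\<And>j. j < k \<Longrightarrow> f j = g j"
    then have "(\<Sum>j<k. f j * q k j) = (\<Sum>j<k. g j * q k j)" by (intro sum.cong) auto
    then show "(\<bar>r\<bar> = 1 \<and> (\<Sum>j<k. f j * q k j) * (r * q k k) \<ge> 0) =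
      (\<bar>r\<bar> = 1 \<and> (\<Sum>j<k. g j * q k j) * (r * q k k) \<ge> 0)" by simp
  next
    fix k and f :: "nat \<Rightarrow> real"
    let ?P = "(\<Sum>j<k. f j * q k j)"
    have "?P * (1 * q k k) \<ge> 0 \<or> ?P * ((-1) * q k k) \<ge> 0" by auto
    then show "\<exists>r. \<bar>r\<bar> = 1 \<and> ?P * (r * q k k) \<ge> 0"
      by (metis abs_minus_cancel abs_one)
  qed
  then show ?thesis using that by blast
qed

text \<open>A gliding hump replaces the completeness of \<open>\<ell>\<^sub>1\<close>. If the bound fails, there are rows \<open>a k\<close> of
  supremum norm at least \<open>4 ^ k\<close> and entries \<open>b (a k) (N k)\<close> that nearly attain it. In a series
  with weights \<open>\<plusminus> 3\<^sup>-\<^sup>k\<close> on these entries, suitable signs prevent the terms before index \<open>k\<close> from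
  cancelling the term \<open>k\<close>, while the geometric tail after it is strictly smaller. So the series evaluated on
  \<open>a k\<close> has absolute value at least a constant times \<open>(4/3) ^ k\<close>.\<close>

lemma uniform_boundedness:
  fixes b :: "'a \<Rightarrow> nat \<Rightarrow> real"
  assumes bd: "\<And>a. a \<in> A \<Longrightarrow> \<exists>M. \<forall>n. \<bar>b a n\<bar> \<le> M"
    and comb: "\<And>N s. (\<And>k. \<bar>s k\<bar> = 1) \<Longrightarrow> \<exists>M. \<forall>a\<in>A. \<bar>\<Sum>k. s k * (1/3) ^ k * b a (N k)\<bar> \<le> M"
  shows "\<exists>M. \<forall>a\<in>A. \<forall>n. \<bar>b a n\<bar> \<le> M"
proof (rule ccontr)
  assume unb: "\<not> ?thesis"
  have "\<exists>a\<in>A. \<exists>n. \<bar>b a n\<bar> \<ge> 4 ^ k \<and> (\<forall>m. \<bar>b a m\<bar> \<le> 4 / 3 * \<bar>b a n\<bar>)" for k :: nat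
  proof -
    obtain a m where a: "a \<in> A" "\<bar>b a m\<bar> > 2 * 4 ^ k"
      using unb by (meson not_le)
    define S where "S = (SUP n. \<bar>b a n\<bar>)"
    obtain M where "\<forall>n. \<bar>b a n\<bar> \<le> M" using bd[OF a(1)] by blast
    then have bdd: "bdd_above (range (\<lambda>n. \<bar>b a n\<bar>))" by (auto intro: bdd_aboveI)
    then have S: "\<bar>b a n\<bar> \<le> S" for n unfolding S_def by (intro cSUP_upper) auto
    have "(0::real) < 2 * 4 ^ k" by simp
    then have Sk: "S > 2 * 4 ^ k" "S > 0" using S[of m] a(2) by linarith+
    then have "3 / 4 * S < S" by simp
    then obtain n where "3 / 4 * S < \<bar>b a n\<bar>"
      using less_cSUP_iff[OF _ bdd, of "3 / 4 * S"] by (auto simp: S_def)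
    moreover have "3 / 4 * S \<ge> 4 ^ k" using Sk by simp
    ultimately have "\<bar>b a n\<bar> \<ge> 4 ^ k" by simp
    moreover have "\<forall>m. \<bar>b a m\<bar> \<le> 4 / 3 * \<bar>b a n\<bar>"
    proof
      fix m show "\<bar>b a m\<bar> \<le> 4 / 3 * \<bar>b a n\<bar>" using S[of m] \<open>3 / 4 * S < \<bar>b a n\<bar>\<close> by simp
    qed
    ultimately show ?thesis using a(1) by blast
  qed
  then obtain a N where aN: "\<And>k. a k \<in> A" "\<And>k. \<bar>b (a k) (N k)\<bar> \<ge> 4 ^ k"
      "\<And>k m. \<bar>b (a k) m\<bar> \<le> 4 / 3 * \<bar>b (a k) (N k)\<bar>"
    by metis
  define q where "q = (\<lambda>k j. (1/3) ^ j * b (a k) (N j))"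
  obtain s where s: "\<And>k. \<bar>s k\<bar> = 1" "\<And>k. (\<Sum>j<k. s j * q k j) * (s k * q k k) \<ge> 0"
    by (rule sign_sequence[of q]) blast
  obtain M where M: "\<forall>a\<in>A. \<bar>\<Sum>k. s k * (1/3) ^ k * b a (N k)\<bar> \<le> M"
    using comb[of s N] s(1) by blast
  have lower: "1 / 3 * (4 / 3) ^ k \<le> M" for k
  proof -
    \<comment> \<open>The hump is \<open>D / 3 ^ k\<close>. The tail is at most
      \<open>4/3 * D * (3\<^sup>-\<^sup>(\<^sup>k\<^sup>+\<^sup>1\<^sup>) + \<dots>) = 2/3 * D / 3 ^ k\<close>, so a third of the hump survives.\<close>
    define D where "D = \<bar>b (a k) (N k)\<bar>"
    have q: "\<bar>s j * q k j\<bar> \<le> 4 / 3 * D * (1/3) ^ j" for j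
      using aN(3)[of k "N j"] s(1)[of j] by (simp add: q_def D_def abs_mult)
    have geo: "summable (\<lambda>j. 4 / 3 * D * (1/3::real) ^ j)"
      by (intro summable_mult summable_geometric) simp
    have sm: "summable (\<lambda>j. s j * q k j)"
      by (rule summable_comparison_test'[OF geo]) (use q in simp)
    have tail: "\<bar>\<Sum>j. s (j + Suc k) * q k (j + Suc k)\<bar> \<le> 2 / 3 * D * (1/3) ^ k"
    proof -
      have "\<bar>\<Sum>j. s (j + Suc k) * q k (j + Suc k)\<bar> \<le> (\<Sum>j. 4 / 3 * D * (1/3) ^ (j + Suc k))"
        unfolding real_norm_def[symmetric]
      proof (rule norm_suminf_le)
        show "summable (\<lambda>j. 4 / 3 * D * (1/3) ^ (j + Suc k))"
          using geo by (rule summable_ignore_initial_segment)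
        show "norm (s (j + Suc k) * q k (j + Suc k)) \<le> 4 / 3 * D * (1/3) ^ (j + Suc k)" for j
          using q[of "j + Suc k"] unfolding real_norm_def .
      qed
      also have "(\<lambda>j. 4 / 3 * D * (1/3) ^ (j + Suc k)) sums (4 / 3 * D * (1/3) ^ Suc k * (1 / (1 - 1/3)))"
        using sums_mult[OF geometric_sums[of "1/3::real"], of "4 / 3 * D * (1/3) ^ Suc k"]
        by (simp add: power_add mult_ac)
      then have "(\<Sum>j. 4 / 3 * D * (1/3) ^ (j + Suc k)) = 2 / 3 * D * (1/3) ^ k"
        by (simp add: sums_unique[symmetric])
      finally show ?thesis .
    qed
    have "(\<Sum>j. s j * q k j) = (\<Sum>j. s (j + Suc k) * q k (j + Suc k)) + (\<Sum>j<k. s j * q k j) + s k * q k k"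
      using suminf_split_initial_segment[OF sm, of "Suc k"] by simp
    moreover have "\<bar>(\<Sum>j<k. s j * q k j) + s k * q k k\<bar> \<ge> \<bar>s k * q k k\<bar>"
      using s(2)[of k] by (auto simp: zero_le_mult_iff)
    moreover have "\<bar>s k * q k k\<bar> = D * (1/3) ^ k"
      using s(1)[of k] by (simp add: q_def D_def abs_mult)
    ultimately have "\<bar>\<Sum>j. s j * q k j\<bar> \<ge> 1 / 3 * (D * (1/3) ^ k)"
      using tail by linarith
    moreover have "\<bar>\<Sum>j. s j * q k j\<bar> \<le> M"
      using M aN(1)[of k] by (simp add: q_def mult.assoc)
    moreover have "(4 / 3) ^ k \<le> D * (1/3::real) ^ k"
      using mult_right_mono[OF aN(2)[of k], of "(1/3) ^ k"]
      by (simp add: D_def power_divide)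
    ultimately show ?thesis by linarith
  qed
  obtain k where "3 * M < (4 / 3 :: real) ^ k"
    using real_arch_pow[of "4/3" "3 * M"] by auto
  then show False using lower[of k] by simp
qed


section \<open>Tychonoff spaces with open countable intersections\<close>

lemma completely_regular_real_function:
  assumes "completely_regular_space X" "closedin X S" "x \<in> topspace X" "x \<notin> S"
  obtains f where "continuous_map X euclideanreal f" "\<And>y. y \<in> topspace X \<Longrightarrow> 0 \<le> f y \<and> f y \<le> 1"
    "f x = 0" "\<And>y. y \<in> S \<Longrightarrow> f y = 1"
proof -
  have "x \<in> topspace X - S" using assms by simp
  then obtain f where f: "continuous_map X (top_of_set {0..1::real}) f" "f x = 0" "f ` S \<subseteq> {1}"
    using assms(1,2) unfolding completely_regular_space_def by metis
  show ?thesis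
  proof
    show "continuous_map X euclideanreal f" using f(1) by (simp add: continuous_map_in_subtopology)
    show "0 \<le> f y \<and> f y \<le> 1" if "y \<in> topspace X" for y
      using f(1) that by (auto simp: continuous_map_in_subtopology)
  qed (use f in auto)
qed

definition P_space :: "'x topology \<Rightarrow> bool" where
  "P_space X \<longleftrightarrow> (\<forall>U :: nat \<Rightarrow> 'x set. (\<forall>n. openin X (U n)) \<longrightarrow> openin X (\<Inter>n. U n))"

lemma P_space_Inter:
  fixes U :: "nat \<Rightarrow> 'x set"
  assumes "P_space X" "\<And>n. openin X (U n)"
  shows "openin X (\<Inter>n. U n)"
  using assms by (simp add: P_space_def)

lemma P_space_countable_closedin:
  assumes P: "P_space X" and haus: "Hausdorff_space X" and D: "countable D" "D \<subseteq> topspace X"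
  shows "closedin X D"
proof (cases "D = {}")
  case False
  define d where "d = from_nat_into D"
  have d: "range d = D" using D False by (simp add: d_def range_from_nat_into)
  have "openin X (topspace X - {d n})" for n
    using d D Hausdorff_imp_t1_space[OF haus] by (auto intro!: openin_diff simp: t1_space_closedin_singleton)
  then have "openin X (\<Inter>n. topspace X - {d n})"
    by (rule P_space_Inter[OF P])
  moreover have "(\<Inter>n. topspace X - {d n}) = topspace X - D" using d by auto
  ultimately show ?thesis using D by (simp add: closedin_def)
qed auto

lemma P_space_countable_discrete:
  assumes "P_space X" "Hausdorff_space X" "countable (topspace X)"
  shows "X = discrete_topology (topspace X)"
proof -
  have "openin X {x}" if "x \<in> topspace X" for x
  proof -
    have "closedin X (topspace X - {x})"
      using assms by (intro P_space_countable_closedin) auto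
    then show ?thesis using that by (auto simp: closedin_def Diff_Diff_Int)
  qed
  then show ?thesis by (metis discrete_topology_unique)
qed

text \<open>The zero set of a real function is a countable intersection of open sets, hence open in a P-space; so
  functions separating points from closed sets give separating clopen sets.\<close>

lemma P_space_clopen_isolating:
  assumes P: "P_space X" and cr: "completely_regular_space X"
    and S: "closedin X S" and x: "x \<in> topspace X" "x \<notin> S"
  obtains Z where "openin X Z" "closedin X Z" "x \<in> Z" "Z \<inter> S = {}"
proof -
  obtain f where f: "continuous_map X euclideanreal f" "f x = 0" "\<And>y. y \<in> S \<Longrightarrow> f y = 1"
    using completely_regular_real_function[OF cr S x] by metis
  define Z where "Z = {y \<in> topspace X. f y \<in> {0}}"
  have "openin X {y \<in> topspace X. f y \<in> ball 0 (1 / Suc n)}" for n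
    using f(1) by (rule openin_continuous_map_preimage) simp
  then have "openin X (\<Inter>n. {y \<in> topspace X. f y \<in> ball 0 (1 / Suc n)})"
    by (rule P_space_Inter[OF P])
  moreover have "(\<Inter>n. {y \<in> topspace X. f y \<in> ball 0 (1 / Suc n)}) = Z"
  proof -
    have "r = 0" if r: "\<And>n. \<bar>r\<bar> < 1 / real (Suc n)" for r :: real
    proof (rule ccontr)
      assume "r \<noteq> 0"
      then obtain n where "inverse (real (Suc n)) < \<bar>r\<bar>" using reals_Archimedean[of "\<bar>r\<bar>"] by auto
      then show False using r[of n] by (simp add: inverse_eq_divide)
    qed
    then show ?thesis unfolding Z_def by auto
  qed
  ultimately have "openin X Z" by simp
  moreover have "closedin X Z"
    unfolding Z_def using f(1) by (rule closedin_continuous_map_preimage) simp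
  moreover have "x \<in> Z" using x f by (simp add: Z_def)
  moreover have "Z \<inter> S = {}" using f(3) by (auto simp: Z_def)
  ultimately show ?thesis using that by blast
qed

text \<open>The clopen sets \<open>Z n\<close> isolate the points of \<open>D\<close> within \<open>D\<close>. Made disjoint, they and the
  complement of their union, which is open because the space is a P-space, form a partition into open sets,
  and a function that is constant on each member of it is continuous.\<close>

lemma P_space_extend_from_countable:
  fixes f :: "'x \<Rightarrow> 'b::topological_space"
  assumes P: "P_space X" and cr: "completely_regular_space X" and haus: "Hausdorff_space X"
    and D: "countable D" "D \<subseteq> topspace X"
  obtains g where "continuous_map X euclidean g" "\<And>x. x \<in> D \<Longrightarrow> g x = f x"
proof (cases "D = {}")
  case True
  then show ?thesis using that[of "\<lambda>_. undefined"] by simp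
next
  case False
  define d where "d = from_nat_into D"
  have d: "range d = D" using D False by (simp add: d_def range_from_nat_into)
  have "\<exists>Z. openin X Z \<and> closedin X Z \<and> d n \<in> Z \<and> Z \<inter> (D - {d n}) = {}" for n
  proof -
    have "closedin X (D - {d n})" using D by (intro P_space_countable_closedin[OF P haus]) auto
    moreover have "d n \<in> topspace X" using d D by blast
    ultimately show ?thesis
      by (rule P_space_clopen_isolating[OF P cr, of "D - {d n}" "d n"]) auto
  qed
  then obtain Z where Z: "\<And>n. openin X (Z n)" "\<And>n. closedin X (Z n)" "\<And>n. d n \<in> Z n"
      "\<And>n. Z n \<inter> (D - {d n}) = {}"
    by metis
  define W where "W = (\<lambda>n. Z n - (\<Union>m<n. Z m))"
  have W: "openin X (W n)" for n
    unfolding W_def using Z by (intro openin_diff closedin_Union) auto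
  define R where "R = (\<Inter>n. topspace X - Z n)"
  have R: "openin X R"
  proof -
    have "openin X (topspace X - Z n)" for n using Z by blast
    then show ?thesis unfolding R_def by (rule P_space_Inter[OF P])
  qed
  define g where "g = (\<lambda>x. if \<exists>n. x \<in> Z n then f (d (LEAST n. x \<in> Z n)) else undefined)"
  have gW: "g x = f (d n)" if "x \<in> W n" for x n
  proof -
    have "(LEAST n. x \<in> Z n) = n"
      using that by (intro Least_equality) (auto simp: W_def not_less[symmetric])
    then show ?thesis using that by (auto simp: g_def W_def)
  qed
  have gR: "g x = undefined" if "x \<in> R" for x using that by (auto simp: g_def R_def)
  have cover: "x \<in> R \<or> (\<exists>n. x \<in> W n)" if "x \<in> topspace X" for x
  proof (cases "\<exists>n. x \<in> Z n")
    case True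
    then have "x \<in> W (LEAST n. x \<in> Z n)"
      by (auto simp: W_def dest: not_less_Least intro: LeastI)
    then show ?thesis by blast
  qed (use that in \<open>auto simp: R_def\<close>)
  show ?thesis
  proof
    have "openin X {x \<in> topspace X. g x \<in> V}" for V
    proof (subst openin_subopen, intro ballI)
      fix x assume x: "x \<in> {x \<in> topspace X. g x \<in> V}"
      then have "x \<in> R \<or> (\<exists>n. x \<in> W n)" using cover by blast
      then show "\<exists>T. openin X T \<and> x \<in> T \<and> T \<subseteq> {x \<in> topspace X. g x \<in> V}"
      proof (elim disjE exE)
        assume "x \<in> R"
        then show ?thesis using x R gR openin_subset[OF R] by (intro exI[of _ R]) auto
      next
        fix n assume "x \<in> W n"
        then show ?thesis using x W gW openin_subset[OF W, of n] by (intro exI[of _ "W n"]) auto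
      qed
    qed
    then show "continuous_map X euclidean g" by (simp add: continuous_map_def)
    show "g x = f x" if "x \<in> D" for x
    proof -
      define n where "n = (LEAST n. x \<in> Z n)"
      have ex: "\<exists>n. x \<in> Z n" using that d Z(3) by blast
      then have "x \<in> Z n" unfolding n_def by (rule LeastI_ex)
      then have "d n = x" using Z(4)[of n] that by auto
      then show ?thesis using ex by (simp add: g_def flip: n_def)
    qed
  qed
qed

section \<open>Free locally convex spaces\<close>

lemma free_lcs_extension:
  fixes X :: "'x topology" and L :: "'v::real_vector topology"
    and f :: "'x \<Rightarrow> 'a::real_normed_vector"
  assumes "free_lcs X L i" "continuous_map X euclidean f"
  obtains g where "g \<in> continuous_linear L euclidean" "\<And>x. x \<in> topspace X \<Longrightarrow> g (i x) = f x"
  using free_lcs_universal[OF assms(1) lcs_euclidean assms(2)] by blast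

lemma free_lcs_image:
  assumes "free_lcs X L i" "x \<in> topspace X"
  shows "i x \<in> topspace L"
  using assms by (auto simp: free_lcs_def continuous_map_def)

lemma continuous_linear_sum:
  assumes "lcs E" "g \<in> continuous_linear E F" "finite T" "e ` T \<subseteq> topspace E"
  shows "g (\<Sum>x\<in>T. c x *\<^sub>R e x) = (\<Sum>x\<in>T. c x *\<^sub>R g (e x))"
  using assms by (intro linear_map_on_sum[of "topspace E"]) (auto simp: continuous_linear_def lcs_def)

lemma free_lcs_finite_combination:
  assumes "free_lcs X L i" "v \<in> topspace L"
  obtains T c where "finite T" "T \<subseteq> topspace X" "v = (\<Sum>x\<in>T. c x *\<^sub>R i x)"
proof -
  have "v \<in> span (i ` topspace X)" using assms(2) free_lcs_span[OF assms(1)] by simp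
  then show ?thesis by (rule span_image_finite_sum) (rule that)
qed

text \<open>The map \<open>i\<close> is injective with linearly independent values because continuous functions separate a
  point from the other points of a finite set; working with combinations indexed by points of \<open>X\<close>
  yields both facts at once.\<close>

lemma free_lcs_combination_zero:
  fixes X :: "'x topology" and L :: "'v::real_vector topology"
  assumes cr: "completely_regular_space X" and haus: "Hausdorff_space X" and free: "free_lcs X L i"
    and T: "finite T" "T \<subseteq> topspace X" and zero: "(\<Sum>x\<in>T. c x *\<^sub>R i x) = 0" and x: "x \<in> T"
  shows "c x = 0"
proof -
  have L: "lcs L" using free by (simp add: free_lcs_def)
  have "closedin X (T - {x})"
    using T Hausdorff_imp_t1_space[OF haus] by (auto simp: t1_space_closedin_finite)
  moreover have "x \<in> topspace X" "x \<notin> T - {x}" using x T by auto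
  ultimately obtain f where f: "continuous_map X euclideanreal f" "f x = 0"
      "\<And>y. y \<in> T - {x} \<Longrightarrow> f y = 1"
    by (rule completely_regular_real_function[OF cr]) metis
  have "continuous_map X euclideanreal (\<lambda>y. 1 - f y)"
    using f(1) by (intro continuous_map_diff) auto
  then obtain g where g: "g \<in> continuous_linear L euclideanreal"
      "\<And>y. y \<in> topspace X \<Longrightarrow> g (i y) = 1 - f y"
    by (rule free_lcs_extension[OF free]) metis
  have "g (\<Sum>y\<in>T. c y *\<^sub>R i y) = (\<Sum>y\<in>T. c y * (1 - f y))"
    using T g(2) continuous_linear_sum[OF L g(1) T(1), of i c] free_lcs_image[OF free]
    by (auto simp: subset_iff intro!: sum.cong)
  also have "\<dots> = (\<Sum>y\<in>{x}. c y * (1 - f y))"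
    using T x f(3) by (intro sum.mono_neutral_right) auto
  also have "g (\<Sum>y\<in>T. c y *\<^sub>R i y) = 0"
    using continuous_linear_sum[OF L g(1), of "{}" i c] zero by simp
  finally show ?thesis using f(2) by simp
qed

lemma free_lcs_basis:
  fixes X :: "'x topology" and L :: "'v::real_vector topology"
  assumes cr: "completely_regular_space X" and haus: "Hausdorff_space X" and free: "free_lcs X L i"
  shows "inj_on i (topspace X)" "independent (i ` topspace X)"
proof -
  show inj: "inj_on i (topspace X)"
  proof (rule inj_onI, rule ccontr)
    fix x y assume xy: "x \<in> topspace X" "y \<in> topspace X" "i x = i y" "x \<noteq> y"
    then have "(\<Sum>z\<in>{x, y}. (if z = x then 1 else -1) *\<^sub>R i z) = 0" by simp
    from free_lcs_combination_zero[OF cr haus free _ _ this, of x] xy show False by simp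
  qed
  show "independent (i ` topspace X)"
    unfolding independent_explicit_module
  proof (intro allI impI)
    fix S u v assume S: "finite S" "S \<subseteq> i ` topspace X" "(\<Sum>v\<in>S. u v *\<^sub>R v) = 0" "v \<in> S"
    then obtain T where T: "T \<subseteq> topspace X" "inj_on i T" "S = i ` T" by (meson subset_image_inj)
    have "(\<Sum>x\<in>T. (u \<circ> i) x *\<^sub>R i x) = 0" using S(3) T by (simp add: sum.reindex)
    moreover have "finite T" using S T finite_imageD by blast
    ultimately show "u v = 0"
      using free_lcs_combination_zero[OF cr haus free _ T(1), of "u \<circ> i"] S(4) T(3) by auto
  qed
qed

text \<open>If \<open>2 (i y - i x)\<close> lies in a neighbourhood of zero whose polar contains \<open>H\<close>, the difference is
  at most 1/2; the factor 2 makes the inequality strict.\<close>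

lemma equicontinuous_on_generators:
  assumes free: "free_lcs X L i" and eq: "equicontinuous L H" and x: "x \<in> topspace X"
  obtains V where "openin X V" "x \<in> V" "\<And>y \<phi>. y \<in> V \<Longrightarrow> \<phi> \<in> H \<Longrightarrow> \<bar>\<phi> (i y) - \<phi> (i x)\<bar> < 1"
proof -
  have L: "lcs L" and ci: "continuous_map X L i" using free by (auto simp: free_lcs_def)
  obtain U where U: "zero_neighbourhood L U" "H \<subseteq> polar L U"
    using eq by (auto simp: equicontinuous_def)
  then obtain V0 where V0: "openin L V0" "0 \<in> V0" "V0 \<subseteq> U"
    by (auto simp: zero_neighbourhood_def)
  let ?h = "\<lambda>y. 2 *\<^sub>R i y + (-2) *\<^sub>R i x"
  have "continuous_map X L ?h"
    using free_lcs_image[OF free x] ci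
    by (intro lcs_continuous_map_add[OF L] lcs_continuous_map_scaleR[OF L]) auto
  then have "openin X {y \<in> topspace X. ?h y \<in> V0}" using V0 by (intro openin_continuous_map_preimage)
  moreover have "x \<in> {y \<in> topspace X. ?h y \<in> V0}" using x V0 by simp
  moreover have "\<bar>\<phi> (i y) - \<phi> (i x)\<bar> < 1" if y: "y \<in> {y \<in> topspace X. ?h y \<in> V0}" and H: "\<phi> \<in> H" for y \<phi>
  proof -
    have \<phi>: "\<phi> \<in> dual L" "\<bar>\<phi> (?h y)\<bar> \<le> 1" using U V0 y H by (auto simp: polar_def)
    have iy: "i y \<in> topspace L" "i x \<in> topspace L" using y x free_lcs_image[OF free] by auto
    then have "2 *\<^sub>R i y \<in> topspace L" "(-2) *\<^sub>R i x \<in> topspace L"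
      using lcs_subspace[OF L] by (auto simp del: scaleR_minus_left intro: subspace_scale)
    then have "\<phi> (?h y) = \<phi> (2 *\<^sub>R i y) + \<phi> ((-2) *\<^sub>R i x)"
      using \<phi>(1) unfolding dual_def by (intro continuous_linear_add)
    moreover have "\<phi> (2 *\<^sub>R i y) = 2 * \<phi> (i y)" "\<phi> ((-2) *\<^sub>R i x) = (-2) * \<phi> (i x)"
      using \<phi>(1) iy unfolding dual_def real_scaleR_def[symmetric]
      by (auto simp only: intro: continuous_linear_scaleR)
    ultimately show ?thesis using \<phi>(2) by linarith
  qed
  ultimately show ?thesis using that by blast
qed

section \<open>Bounded sets in a free locally convex space\<close>

lemma continuous_map_signed_series:
  fixes f :: "nat \<Rightarrow> 'x \<Rightarrow> real"
  assumes f: "\<And>n. continuous_map X euclideanreal (f n)"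
    and bd: "\<And>n x. x \<in> topspace X \<Longrightarrow> \<bar>f n x\<bar> \<le> 1" and s: "\<And>k. \<bar>s k\<bar> = 1"
  shows "continuous_map X euclideanreal (\<lambda>x. \<Sum>k. s k * (1/3) ^ k * f (N k) x)"
    and "\<And>x. x \<in> topspace X \<Longrightarrow> summable (\<lambda>k. s k * (1/3) ^ k * f (N k) x)"
proof -
  have le: "norm (s k * (1/3) ^ k * f (N k) x) \<le> (1/3) ^ k" if "x \<in> topspace X" for k x
    using bd[OF that, of "N k"] s[of k] by (simp add: abs_mult mult_left_le)
  have geo: "summable (\<lambda>k. (1/3::real) ^ k)" by (rule summable_geometric) simp
  show "summable (\<lambda>k. s k * (1/3) ^ k * f (N k) x)" if "x \<in> topspace X" for x
    by (rule summable_comparison_test'[OF geo]) (rule le[OF that])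
  have ul: "uniform_limit (topspace X) (\<lambda>n x. \<Sum>k<n. s k * (1/3) ^ k * f (N k) x)
      (\<lambda>x. \<Sum>k. s k * (1/3) ^ k * f (N k) x) sequentially"
    by (rule Weierstrass_m_test[OF _ geo]) (rule le)
  have "continuous_map X Met_TC.mtopology (\<lambda>x. \<Sum>k. s k * (1/3) ^ k * f (N k) x)"
  proof (rule Met_TC.continuous_map_uniform_limit)
    show "\<forall>\<^sub>F n in sequentially.
        continuous_map X Met_TC.mtopology (\<lambda>x. \<Sum>k<n. s k * (1/3) ^ k * f (N k) x)"
      using f by (simp add: continuous_map_sum continuous_map_real_mult_left)
    show "\<forall>\<^sub>F n in sequentially. \<forall>x\<in>topspace X. (\<Sum>k. s k * (1/3) ^ k * f (N k) x) \<in> UNIV \<and>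
        dist (\<Sum>k<n. s k * (1/3) ^ k * f (N k) x) (\<Sum>k. s k * (1/3) ^ k * f (N k) x) < e"
      if "e > 0" for e
      using uniform_limitD[OF ul that] by simp
  qed simp
  then show "continuous_map X euclideanreal (\<lambda>x. \<Sum>k. s k * (1/3) ^ k * f (N k) x)"
    by simp
qed

text \<open>On one element of \<open>L\<close> the sequence \<open>\<phi>\<close> is bounded by the sum of the absolute values of its
  coefficients. A signed series with geometric weights of the functions \<open>f n\<close> is again continuous on
  \<open>X\<close>, so it extends to a continuous functional, which is bounded on every bounded set. These are the two
  hypotheses of the uniform boundedness principle.\<close>

lemma uniformly_bounded_imp_strongly_bounded:
  fixes X :: "'x topology" and L :: "'v::real_vector topology" and \<phi> :: "nat \<Rightarrow> 'v \<Rightarrow> real"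
  assumes free: "free_lcs X L i" and f: "\<And>n. continuous_map X euclideanreal (f n)"
    and bd: "\<And>n x. x \<in> topspace X \<Longrightarrow> \<bar>f n x\<bar> \<le> 1"
    and \<phi>: "\<And>n. \<phi> n \<in> dual L" "\<And>n x. x \<in> topspace X \<Longrightarrow> \<phi> n (i x) = f n x"
  shows "bounded_in (strong_dual L) (range \<phi>)"
proof -
  have L: "lcs L" using free by (simp add: free_lcs_def)
  note iX = free_lcs_image[OF free]
  have eval: "\<phi> n (\<Sum>x\<in>T. c x *\<^sub>R i x) = (\<Sum>x\<in>T. c x * f n x)"
    if T: "finite T" "T \<subseteq> topspace X" for n T c
  proof -
    have "i ` T \<subseteq> topspace L" using iX T by blast
    then have "\<phi> n (\<Sum>x\<in>T. c x *\<^sub>R i x) = (\<Sum>x\<in>T. c x *\<^sub>R \<phi> n (i x))"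
      using \<phi>(1)[of n] T by (intro continuous_linear_sum[OF L]) (auto simp: dual_def)
    also have "\<dots> = (\<Sum>x\<in>T. c x * f n x)" using T \<phi>(2) by (intro sum.cong) auto
    finally show ?thesis .
  qed
  show ?thesis
  proof (rule bounded_in_strong_dualI[OF L])
    show "range \<phi> \<subseteq> dual L" using \<phi>(1) by blast
    fix B assume B: "bounded_in L B"
    have BL: "B \<subseteq> topspace L" using B by (simp add: bounded_in_def)
    have "\<exists>M. \<forall>a\<in>B. \<forall>n. \<bar>\<phi> n a\<bar> \<le> M"
    proof (rule uniform_boundedness)
      fix a assume "a \<in> B"
      then have "a \<in> topspace L" using BL by blast
      then obtain T c where T: "finite T" "T \<subseteq> topspace X" "a = (\<Sum>x\<in>T. c x *\<^sub>R i x)"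
        by (rule free_lcs_finite_combination[OF free])
      have "\<bar>\<phi> n a\<bar> \<le> (\<Sum>x\<in>T. \<bar>c x\<bar>)" for n
      proof -
        have "\<bar>\<phi> n a\<bar> \<le> (\<Sum>x\<in>T. \<bar>c x * f n x\<bar>)"
          unfolding T(3) eval[OF T(1,2)] by (rule sum_abs)
        also have "\<dots> \<le> (\<Sum>x\<in>T. \<bar>c x\<bar>)"
          using T bd by (intro sum_mono) (auto simp: abs_mult mult_left_le)
        finally show ?thesis .
      qed
      then show "\<exists>M. \<forall>n. \<bar>\<phi> n a\<bar> \<le> M" by blast
    next
      fix N :: "nat \<Rightarrow> nat" and s :: "nat \<Rightarrow> real"
      assume s: "\<And>k. \<bar>s k\<bar> = 1"
      define h where "h = (\<lambda>x. \<Sum>k. s k * (1/3) ^ k * f (N k) x)"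
      note series = continuous_map_signed_series[where f = f and s = s and N = N, OF f bd s]
      have "continuous_map X euclideanreal h" unfolding h_def by (rule series(1))
      then obtain \<psi> where \<psi>: "\<psi> \<in> continuous_linear L euclideanreal"
          "\<And>x. x \<in> topspace X \<Longrightarrow> \<psi> (i x) = h x"
        by (rule free_lcs_extension[OF free]) metis
      obtain M where M: "\<forall>a\<in>B. norm (\<psi> a) \<le> M"
        using bounded_in_continuous_linear[OF L \<psi>(1) B] by blast
      have "\<bar>\<Sum>k. s k * (1/3) ^ k * \<phi> (N k) a\<bar> \<le> M" if a: "a \<in> B" for a
      proof -
        have "a \<in> topspace L" using BL a by blast
        then obtain T c where T: "finite T" "T \<subseteq> topspace X" "a = (\<Sum>x\<in>T. c x *\<^sub>R i x)"
          by (rule free_lcs_finite_combination[OF free])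
        have iT: "i ` T \<subseteq> topspace L" using iX T by blast
        have "(\<lambda>k. s k * (1/3) ^ k * f (N k) x) sums h x" if "x \<in> T" for x
          unfolding h_def using series(2) T that by (intro summable_sums) blast
        then have "(\<lambda>k. \<Sum>x\<in>T. c x * (s k * (1/3) ^ k * f (N k) x)) sums (\<Sum>x\<in>T. c x * h x)"
          by (intro sums_sum sums_mult)
        moreover have "(\<Sum>x\<in>T. c x * (s k * (1/3) ^ k * f (N k) x)) = s k * (1/3) ^ k * \<phi> (N k) a" for k
          unfolding T(3) eval[OF T(1,2)] by (simp add: sum_distrib_left mult_ac)
        moreover have "\<psi> a = (\<Sum>x\<in>T. c x * h x)"
          unfolding T(3) continuous_linear_sum[OF L \<psi>(1) T(1) iT]
          using T \<psi>(2) by (intro sum.cong) auto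
        ultimately have "(\<Sum>k. s k * (1/3) ^ k * \<phi> (N k) a) = \<psi> a" by (simp add: sums_unique[symmetric])
        then show ?thesis using M a by simp
      qed
      then show "\<exists>M. \<forall>a\<in>B. \<bar>\<Sum>k. s k * (1/3) ^ k * \<phi> (N k) a\<bar> \<le> M" by blast
    qed
    then show "\<exists>M. \<forall>\<psi>\<in>range \<phi>. \<forall>x\<in>B. \<bar>\<psi> x\<bar> \<le> M" by blast
  qed
qed

text \<open>Take functions with values in \<open>[0, 1]\<close> that vanish at \<open>x\<close> and are 1 off \<open>U n\<close>. As a uniformly
  bounded sequence they are equicontinuous, so some neighbourhood of \<open>x\<close> lies in all \<open>U n\<close>.\<close>

lemma linf_quasibarrelled_imp_P_space:
  fixes X :: "'x topology" and L :: "'v::real_vector topology"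
  assumes cr: "completely_regular_space X" and free: "free_lcs X L i"
    and q: "linf_quasibarrelled L"
  shows "P_space X"
  unfolding P_space_def
proof (intro allI impI)
  fix U :: "nat \<Rightarrow> 'x set" assume U: "\<forall>n. openin X (U n)"
  show "openin X (\<Inter>n. U n)"
  proof (subst openin_subopen, intro ballI)
    fix x assume x: "x \<in> (\<Inter>n. U n)"
    have xX: "x \<in> topspace X" using x U openin_subset by blast
    have "\<exists>f. continuous_map X euclideanreal f \<and> (\<forall>y\<in>topspace X. 0 \<le> f y \<and> f y \<le> 1) \<and>
        f x = 0 \<and> (\<forall>y\<in>topspace X - U n. f y = 1)" for n
    proof -
      have "closedin X (topspace X - U n)" using U by blast
      moreover have "x \<notin> topspace X - U n" using x by blast
      ultimately show ?thesis
        using completely_regular_real_function[OF cr _ xX, of "topspace X - U n"] by metis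
    qed
    then obtain f where f: "\<And>n. continuous_map X euclideanreal (f n)"
        "\<And>n y. y \<in> topspace X \<Longrightarrow> 0 \<le> f n y \<and> f n y \<le> (1::real)" "\<And>n. f n x = 0"
        "\<And>n y. y \<in> topspace X - U n \<Longrightarrow> f n y = 1"
      by metis
    have "\<exists>g. g \<in> dual L \<and> (\<forall>y\<in>topspace X. g (i y) = f n y)" for n
      by (rule free_lcs_extension[OF free f(1)[of n]]) (auto simp: dual_def)
    then obtain \<phi> where \<phi>: "\<And>n. \<phi> n \<in> dual L" "\<And>n y. y \<in> topspace X \<Longrightarrow> \<phi> n (i y) = f n y"
      by metis
    have "\<bar>f n y\<bar> \<le> 1" if "y \<in> topspace X" for n y using f(2)[OF that, of n] by simp
    then have "bounded_in (strong_dual L) (range \<phi>)"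
      by (rule uniformly_bounded_imp_strongly_bounded[where f = f, OF free f(1) _ \<phi>(1) \<phi>(2)])
    then have "equicontinuous L (range \<phi>)" using q by (simp add: linf_quasibarrelled_def)
    then obtain V where V: "openin X V" "x \<in> V" "\<And>y \<psi>. y \<in> V \<Longrightarrow> \<psi> \<in> range \<phi> \<Longrightarrow> \<bar>\<psi> (i y) - \<psi> (i x)\<bar> < 1"
      by (rule equicontinuous_on_generators[OF free _ xX]) metis
    have "V \<subseteq> (\<Inter>n. U n)"
    proof (intro subsetI INT_I)
      fix y n assume y: "y \<in> V"
      then have yX: "y \<in> topspace X" using V(1) openin_subset by blast
      then have "\<bar>f n y\<bar> < 1" using V(3)[OF y, of "\<phi> n"] \<phi>(2) xX f(3) by simp
      then show "y \<in> U n" using f(4)[of y n] yX by force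
    qed
    then show "\<exists>T. openin X T \<and> x \<in> T \<and> T \<subseteq> (\<Inter>n. U n)" using V by blast
  qed
qed

text \<open>The unit vectors of \<open>\<ell>\<^sub>\<infinity>\<close>, realized as the bounded functions on the discrete space \<open>nat\<close>. As values
  of maps from \<open>X\<close> they turn countably many weighted coordinates of \<open>L\<close> into one norm.\<close>

definition unit_bcontfun :: "nat \<Rightarrow> nat \<Rightarrow>\<^sub>C real" where
  "unit_bcontfun k = Bcontfun (\<lambda>n. if n = k then 1 else 0)"

lemma apply_unit_bcontfun [simp]: "apply_bcontfun (unit_bcontfun k) n = (if n = k then 1 else 0)"
proof -
  have "(\<lambda>n. if n = k then 1 else 0 :: real) \<in> bcontfun"
    by (rule bcontfun_normI[of _ 1]) auto
  then show ?thesis by (simp add: unit_bcontfun_def Bcontfun_inverse)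
qed

lemma apply_bcontfun_sum:
  "apply_bcontfun (\<Sum>x\<in>T. c x *\<^sub>R h x) n = (\<Sum>x\<in>T. c x *\<^sub>R apply_bcontfun (h x) n)"
  by (induction T rule: infinite_finite_induct) (auto simp: plus_bcontfun.rep_eq scaleR_bcontfun.rep_eq)

text \<open>Suppose that infinitely many points \<open>x k\<close> occur in the supports of elements \<open>a k\<close> of \<open>A\<close>. Map
  \<open>x k\<close> to the \<open>k\<close>th unit vector of \<open>\<ell>\<^sub>\<infinity>\<close>, weighted so that the \<open>k\<close>th coordinate of the image
  of \<open>a k\<close> is \<open>k\<close>, and map all other points of the supports to 0. This is a function on a countable
  set, so it extends to \<open>X\<close> and then to \<open>L\<close>, and the extension is unbounded on \<open>A\<close>. Unit
  vectors, rather than scalars, keep the contributions of different points apart.\<close>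

lemma P_space_bounded_finite_dimensional:
  fixes X :: "'x topology" and L :: "'v::real_vector topology"
  assumes P: "P_space X" and cr: "completely_regular_space X" and haus: "Hausdorff_space X"
    and free: "free_lcs X L i" and A: "bounded_in L A"
  obtains F where "finite F" "F \<subseteq> topspace X" "A \<subseteq> span (i ` F)"
proof -
  have L: "lcs L" using free by (simp add: free_lcs_def)
  note inj = free_lcs_basis(1)[OF cr haus free] and indep = free_lcs_basis(2)[OF cr haus free]
  have AL: "A \<subseteq> topspace L" using A by (simp add: bounded_in_def)
  define coord where "coord = (\<lambda>v x. representation (i ` topspace X) v (i x))"
  define supp where "supp = (\<lambda>v. {x \<in> topspace X. coord v x \<noteq> 0})"
  have i_supp: "{b. representation (i ` topspace X) v b \<noteq> 0} = i ` supp v" for v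
    using representation_ne_zero[of "i ` topspace X" v] by (auto simp: supp_def coord_def)
  have inj_supp: "inj_on i (supp v)" for v
    using inj by (rule inj_on_subset) (auto simp: supp_def)
  have fin: "finite (supp v)" for v
    using finite_representation[of "i ` topspace X" v] inj_supp[of v]
    unfolding i_supp by (rule finite_imageD)
  have expand: "(\<Sum>x\<in>supp v. coord v x *\<^sub>R i x) = v" if "v \<in> topspace L" for v
  proof -
    have "v \<in> span (i ` topspace X)" using that free_lcs_span[OF free] by simp
    from sum_nonzero_representation_eq[OF indep this]
    show ?thesis unfolding i_supp by (simp add: sum.reindex[OF inj_supp] coord_def)
  qed
  define S where "S = (\<Union>a\<in>A. supp a)"
  have "finite S"
  proof (rule ccontr)
    assume "infinite S"
    then obtain x :: "nat \<Rightarrow> 'x" where x: "inj x" "range x \<subseteq> S"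
      using infinite_countable_subset by blast
    have "\<exists>a. a \<in> A \<and> x k \<in> supp a" for k using x(2) by (auto simp: S_def)
    then obtain a where a: "\<And>k. a k \<in> A" "\<And>k. x k \<in> supp (a k)" by metis
    \<comment> \<open>All of the supports, and not only the points \<open>x k\<close>, are needed here: the extension must also
      have prescribed values at the remaining points that occur in \<open>a k\<close>.\<close>
    define D where "D = (\<Union>k. supp (a k))"
    have D: "countable D" "D \<subseteq> topspace X"
      using fin by (auto simp: D_def supp_def countable_finite)
    define f where "f = (\<lambda>y. if y \<in> range x then
      (real (inv x y) / coord (a (inv x y)) y) *\<^sub>R unit_bcontfun (inv x y) else 0)"
    obtain g where g: "continuous_map X euclidean g" "\<And>y. y \<in> D \<Longrightarrow> g y = f y"
      by (rule P_space_extend_from_countable[OF P cr haus D, of f]) metis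
    obtain G where G: "G \<in> continuous_linear L euclidean" "\<And>y. y \<in> topspace X \<Longrightarrow> G (i y) = g y"
      by (rule free_lcs_extension[OF free g(1)]) metis
    obtain M where M: "\<forall>v\<in>A. norm (G v) \<le> M" using bounded_in_continuous_linear[OF L G(1) A] by blast
    have "real k \<le> M" for k
    proof -
      have ak: "a k \<in> topspace L" using a(1) AL by blast
      have sub: "i ` supp (a k) \<subseteq> topspace L"
        using free_lcs_image[OF free] by (auto simp: supp_def)
      have "G (a k) = (\<Sum>y\<in>supp (a k). coord (a k) y *\<^sub>R G (i y))"
        using continuous_linear_sum[OF L G(1) fin sub, of "coord (a k)"] expand[OF ak] by simp
      also have "\<dots> = (\<Sum>y\<in>supp (a k). coord (a k) y *\<^sub>R f y)"
      proof (rule sum.cong[OF refl])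
        fix y assume y: "y \<in> supp (a k)"
        then have "y \<in> topspace X" "y \<in> D" by (auto simp: supp_def D_def)
        then show "coord (a k) y *\<^sub>R G (i y) = coord (a k) y *\<^sub>R f y" using G g by simp
      qed
      finally have "apply_bcontfun (G (a k)) k =
          (\<Sum>y\<in>supp (a k). coord (a k) y *\<^sub>R apply_bcontfun (f y) k)"
        by (simp only: apply_bcontfun_sum)
      also have "\<dots> = (\<Sum>y\<in>{x k}. coord (a k) y *\<^sub>R apply_bcontfun (f y) k)"
      proof (rule sum.mono_neutral_right[OF fin])
        show "\<forall>y\<in>supp (a k) - {x k}. coord (a k) y *\<^sub>R apply_bcontfun (f y) k = 0"
          using x(1) by (auto simp: f_def scaleR_bcontfun.rep_eq)
      qed (use a(2) in auto)
      also have "\<dots> = real k"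
        using a(2)[of k] x(1) by (simp add: f_def supp_def scaleR_bcontfun.rep_eq)
      finally have "real k \<le> norm (G (a k))" using norm_bounded[of "G (a k)" k] by simp
      also have "\<dots> \<le> M" using M a(1) by blast
      finally show ?thesis .
    qed
    then show False using reals_Archimedean2[of M] by (meson not_less)
  qed
  moreover have "S \<subseteq> topspace X" by (auto simp: S_def supp_def)
  moreover have "A \<subseteq> span (i ` S)"
  proof
    fix v assume v: "v \<in> A"
    then have "(\<Sum>x\<in>supp v. coord v x *\<^sub>R i x) \<in> span (i ` S)"
      by (intro span_sum span_scale span_base) (auto simp: S_def)
    then show "v \<in> span (i ` S)" using expand v AL by auto
  qed
  ultimately show ?thesis using that by blast
qed

text \<open>Each member of a fundamental bounded sequence is supported by a finite set, and every singleton
  \<open>{i x}\<close> is contained in some member; by linear independence \<open>x\<close> then belongs to its finite set.\<close>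

lemma almost_DF_imp_countable_discrete:
  fixes X :: "'x topology" and L :: "'v::real_vector topology"
  assumes cr: "completely_regular_space X" and haus: "Hausdorff_space X"
    and free: "free_lcs X L i" and DF: "almost_DF_space L"
  shows "countable (topspace X) \<and> X = discrete_topology (topspace X)"
proof -
  have L: "lcs L" using free by (simp add: free_lcs_def)
  have P: "P_space X"
    using DF by (intro linf_quasibarrelled_imp_P_space[OF cr free]) (simp add: almost_DF_space_def)
  obtain B where "fundamental_bounded_sequence L B" using DF by (auto simp: almost_DF_space_def)
  then have B: "\<And>n. bounded_in L (B n)" "\<And>A. bounded_in L A \<Longrightarrow> \<exists>n. A \<subseteq> B n"
    by (simp_all add: fundamental_bounded_sequence_def)
  have "\<exists>F. finite F \<and> F \<subseteq> topspace X \<and> B n \<subseteq> span (i ` F)" for n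
    using P_space_bounded_finite_dimensional[OF P cr haus free B(1)[of n]] by metis
  then obtain F where F: "\<And>n. finite (F n)" "\<And>n. F n \<subseteq> topspace X" "\<And>n. B n \<subseteq> span (i ` F n)"
    by metis
  have "topspace X \<subseteq> (\<Union>n. F n)"
  proof
    fix x assume x: "x \<in> topspace X"
    obtain n where "{i x} \<subseteq> B n"
      using B(2) bounded_in_singleton[OF L free_lcs_image[OF free x]] by blast
    then have ix: "i x \<in> span (i ` F n)" using F(3) by blast
    have "x \<in> F n"
    proof (rule ccontr)
      assume "x \<notin> F n"
      then have "i ` F n \<subseteq> i ` topspace X - {i x}"
        using free_lcs_basis(1)[OF cr haus free] F(2)[of n] x by (auto simp: inj_on_def subset_iff)
      then have "i x \<in> span (i ` topspace X - {i x})" using ix span_mono by blast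
      then show False
        using free_lcs_basis(2)[OF cr haus free] x unfolding dependent_def by blast
    qed
    then show "x \<in> (\<Union>n. F n)" by blast
  qed
  then have "countable (topspace X)"
    using F(1) by (meson countable_UN countable_finite countable_subset countableI_type)
  then show ?thesis using P_space_countable_discrete[OF P haus] by blast
qed

section \<open>Countable discrete spaces\<close>

lemma discrete_P_space: "X = discrete_topology (topspace X) \<Longrightarrow> P_space X"
  unfolding P_space_def by (metis INT_lower UNIV_I openin_discrete_topology subset_trans)

lemma continuous_map_from_discrete:
  assumes "X = discrete_topology (topspace X)"
  shows "continuous_map X euclidean f"
  by (subst assms) simp

lemma countable_discrete_fundamental_bounded_sequence:
  fixes X :: "'x topology" and L :: "'v::real_vector topology"
  assumes cr: "completely_regular_space X" and haus: "Hausdorff_space X"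
    and free: "free_lcs X L i" and count: "countable (topspace X)"
    and disc: "X = discrete_topology (topspace X)"
  obtains B where "fundamental_bounded_sequence L B"
proof -
  have L: "lcs L" using free by (simp add: free_lcs_def)
  define k where "k = to_nat_on (topspace X)"
  have injk: "inj_on k (topspace X)" using inj_on_to_nat_on[OF count] by (simp add: k_def)
  define F where "F = (\<lambda>n. {x \<in> topspace X. k x \<le> n})"
  have F: "finite (F n)" "F n \<subseteq> topspace X" for n
  proof -
    show "F n \<subseteq> topspace X" by (auto simp: F_def)
    have "k ` F n \<subseteq> {..n}" by (auto simp: F_def)
    then have "finite (k ` F n)" by (rule finite_subset) simp
    moreover have "inj_on k (F n)" using injk by (rule inj_on_subset) (auto simp: F_def)
    ultimately show "finite (F n)" by (rule finite_imageD)
  qed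
  define B where "B = (\<lambda>n. {\<Sum>x\<in>F n. c x *\<^sub>R i x |c. \<forall>x\<in>F n. \<bar>c x\<bar> \<le> real n})"
  have BI: "(\<Sum>x\<in>T. c x *\<^sub>R i x) \<in> B n" if T: "T \<subseteq> F n" "\<And>x. x \<in> T \<Longrightarrow> \<bar>c x\<bar> \<le> real n" for T c n
  proof -
    let ?c = "\<lambda>x. if x \<in> T then c x else 0"
    have "(\<Sum>x\<in>T. c x *\<^sub>R i x) = (\<Sum>x\<in>F n. ?c x *\<^sub>R i x)"
      using T F by (intro sum.mono_neutral_cong_left) auto
    moreover have "\<forall>x\<in>F n. \<bar>?c x\<bar> \<le> real n" using T by auto
    ultimately show ?thesis unfolding B_def mem_Collect_eq by (intro exI[of _ ?c] conjI)
  qed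
  have "fundamental_bounded_sequence L B"
    unfolding fundamental_bounded_sequence_def
  proof (intro conjI allI impI)
    show "incseq B"
    proof (rule incseq_SucI, rule subsetI)
      fix n v assume "v \<in> B n"
      then obtain c where c: "v = (\<Sum>x\<in>F n. c x *\<^sub>R i x)" "\<forall>x\<in>F n. \<bar>c x\<bar> \<le> real n"
        by (auto simp: B_def)
      show "v \<in> B (Suc n)" unfolding c(1) by (rule BI) (use c(2) in \<open>force simp: F_def\<close>)+
    qed
    show "bounded_in L (B n)" for n
      unfolding B_def using F free_lcs_image[OF free] by (intro bounded_in_box[OF L]) auto
    fix A assume A: "bounded_in L A"
    obtain H where H: "finite H" "H \<subseteq> topspace X" "A \<subseteq> span (i ` H)"
      by (rule P_space_bounded_finite_dimensional[OF discrete_P_space[OF disc] cr haus free A])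
    have "\<exists>g M. g \<in> continuous_linear L euclideanreal \<and>
        (\<forall>y\<in>topspace X. g (i y) = (if y = x then 1 else 0)) \<and> (\<forall>v\<in>A. \<bar>g v\<bar> \<le> M)" for x
    proof -
      obtain g where g: "g \<in> continuous_linear L euclideanreal"
          "\<And>y. y \<in> topspace X \<Longrightarrow> g (i y) = (if y = x then 1 else 0)"
        by (rule free_lcs_extension[OF free continuous_map_from_discrete[OF disc],
              of "\<lambda>y. if y = x then 1 else 0 :: real"]) metis
      moreover have "\<exists>M. \<forall>v\<in>A. \<bar>g v\<bar> \<le> M"
        using bounded_in_continuous_linear[OF L g(1) A] by simp
      ultimately show ?thesis by blast
    qed
    then obtain g M where g: "\<And>x. g x \<in> continuous_linear L euclideanreal"
        "\<And>x y. y \<in> topspace X \<Longrightarrow> g x (i y) = (if y = x then 1 else 0)"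
        "\<And>x v. v \<in> A \<Longrightarrow> \<bar>g x v\<bar> \<le> M x"
      by metis
    define n where "n = (\<Sum>x\<in>H. k x + nat \<lceil>M x\<rceil>)"
    have n: "k x \<le> n" "M x \<le> real n" if "x \<in> H" for x
    proof -
      have "k x + nat \<lceil>M x\<rceil> \<le> n"
        unfolding n_def using H(1) that by (intro member_le_sum) auto
      then show "k x \<le> n" "M x \<le> real n" by linarith+
    qed
    have "A \<subseteq> B n"
    proof
      fix v assume v: "v \<in> A"
      then have "v \<in> span (i ` H)" using H by blast
      then obtain T c where T: "finite T" "T \<subseteq> H" "v = (\<Sum>x\<in>T. c x *\<^sub>R i x)"
        by (rule span_image_finite_sum)
      have TX: "T \<subseteq> topspace X" using T H by blast
      then have iT: "i ` T \<subseteq> topspace L" using free_lcs_image[OF free] by blast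
      have "\<bar>c x\<bar> \<le> real n" if x: "x \<in> T" for x
      proof -
        have "g x v = (\<Sum>y\<in>T. c y *\<^sub>R g x (i y))"
          unfolding T(3) by (rule continuous_linear_sum[OF L g(1) T(1) iT])
        also have "\<dots> = (\<Sum>y\<in>T. if y = x then c y else 0)"
          using TX g(2) by (intro sum.cong) auto
        also have "\<dots> = c x" using x T(1) by simp
        finally show ?thesis using g(3)[OF v, of x] n(2)[of x] x T(2) by auto
      qed
      moreover have "T \<subseteq> F n" using T(2) TX n(1) by (auto simp: F_def)
      ultimately show "v \<in> B n" unfolding T(3) by (intro BI)
    qed
    then show "\<exists>n. A \<subseteq> B n" by blast
  qed
  then show ?thesis by (rule that)
qed

text \<open>Let \<open>w x\<close> bound \<open>H\<close> at \<open>i x\<close>. The functionals in \<open>H\<close> are dominated by the seminorm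
  \<open>\<Sum>x. w x * \<bar>c x\<bar>\<close> of the coefficients, which is of type \<open>\<ell>\<^sub>1\<close>. Since \<open>X\<close> is
  countable, twice a supremum norm with the additional weights \<open>2 ^ k x\<close> dominates it, and this norm is
  continuous on \<open>L\<close>: it is the norm in \<open>\<ell>\<^sub>\<infinity>\<close> of the operator that extends the function
  \<open>f\<close>, which is continuous because \<open>X\<close> is discrete.\<close>

lemma countable_discrete_pointwise_bounded_equicontinuous:
  fixes X :: "'x topology" and L :: "'v::real_vector topology"
  assumes free: "free_lcs X L i" and count: "countable (topspace X)"
    and disc: "X = discrete_topology (topspace X)"
    and H: "H \<subseteq> dual L" and bd: "\<And>x. x \<in> topspace X \<Longrightarrow> \<exists>M. \<forall>\<phi>\<in>H. \<bar>\<phi> (i x)\<bar> \<le> M"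
  shows "equicontinuous L H"
proof -
  have L: "lcs L" using free by (simp add: free_lcs_def)
  obtain w0 where w0: "\<And>x \<phi>. x \<in> topspace X \<Longrightarrow> \<phi> \<in> H \<Longrightarrow> \<bar>\<phi> (i x)\<bar> \<le> w0 x"
    using bd by metis
  define w where "w = (\<lambda>x. \<bar>w0 x\<bar>)"
  have w: "w x \<ge> 0" "x \<in> topspace X \<Longrightarrow> \<phi> \<in> H \<Longrightarrow> \<bar>\<phi> (i x)\<bar> \<le> w x" for x \<phi>
    using w0[of x \<phi>] by (auto simp: w_def)
  define k where "k = to_nat_on (topspace X)"
  have injk: "inj_on k (topspace X)" using inj_on_to_nat_on[OF count] by (simp add: k_def)
  define f where "f = (\<lambda>x. (2 ^ k x * w x) *\<^sub>R unit_bcontfun (k x))"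
  obtain G where G: "G \<in> continuous_linear L euclidean" "\<And>y. y \<in> topspace X \<Longrightarrow> G (i y) = f y"
    by (rule free_lcs_extension[OF free continuous_map_from_discrete[OF disc], of f]) metis
  define U where "U = {v \<in> topspace L. norm (G v) < 1 / 2}"
  have "zero_neighbourhood L U"
    unfolding U_def by (rule continuous_linear_zero_neighbourhood[OF L G(1)]) simp
  moreover have "\<bar>\<phi> v\<bar> \<le> 1" if \<phi>: "\<phi> \<in> H" and v: "v \<in> U" for \<phi> v
  proof -
    have "v \<in> topspace L" using v by (simp add: U_def)
    then obtain T c where T: "finite T" "T \<subseteq> topspace X" "v = (\<Sum>x\<in>T. c x *\<^sub>R i x)"
      by (rule free_lcs_finite_combination[OF free])
    have iT: "i ` T \<subseteq> topspace L" using T free_lcs_image[OF free] by blast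
    have injT: "inj_on k T" using injk T(2) by (rule inj_on_subset)
    have "G v = (\<Sum>x\<in>T. c x *\<^sub>R f x)"
      unfolding T(3) continuous_linear_sum[OF L G(1) T(1) iT]
      using T(2) G(2) by (intro sum.cong) auto
    then have Gv: "apply_bcontfun (G v) n = (\<Sum>x\<in>T. c x *\<^sub>R apply_bcontfun (f x) n)" for n
      by (simp only: apply_bcontfun_sum)
    have le: "\<bar>c x * \<phi> (i x)\<bar> \<le> (1 / 2) ^ Suc (k x)" if x: "x \<in> T" for x
    proof -
      have "apply_bcontfun (G v) (k x) = (\<Sum>y\<in>{x}. c y *\<^sub>R apply_bcontfun (f y) (k x))"
        unfolding Gv
      proof (rule sum.mono_neutral_right[OF T(1)])
        show "\<forall>y\<in>T - {x}. c y *\<^sub>R apply_bcontfun (f y) (k x) = 0"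
          using injT x by (auto simp: f_def scaleR_bcontfun.rep_eq inj_on_def)
      qed (use x in auto)
      also have "\<dots> = c x * (2 ^ k x * w x)" by (simp add: f_def scaleR_bcontfun.rep_eq)
      finally have "\<bar>c x * (2 ^ k x * w x)\<bar> \<le> norm (G v)"
        using norm_bounded[of "G v" "k x"] by simp
      also have "\<dots> \<le> 1 / 2" using v by (simp add: U_def)
      finally have "2 ^ k x * (\<bar>c x\<bar> * w x) \<le> 1 / 2" using w(1)[of x] by (simp add: abs_mult mult_ac)
      then have "\<bar>c x\<bar> * w x \<le> (1 / 2) ^ Suc (k x)" by (simp add: field_simps power_divide)
      moreover have "\<bar>c x * \<phi> (i x)\<bar> \<le> \<bar>c x\<bar> * w x"
        using w(2)[of x \<phi>] \<phi> x T(2) by (auto simp: abs_mult intro!: mult_left_mono)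
      ultimately show ?thesis by linarith
    qed
    have "\<phi> v = (\<Sum>x\<in>T. c x *\<^sub>R \<phi> (i x))"
      unfolding T(3) using \<phi> H T(1) iT by (intro continuous_linear_sum[OF L]) (auto simp: dual_def)
    then have "\<bar>\<phi> v\<bar> \<le> (\<Sum>x\<in>T. \<bar>c x * \<phi> (i x)\<bar>)" by (simp add: sum_abs)
    also have "\<dots> \<le> (\<Sum>x\<in>T. (1 / 2) ^ Suc (k x))" by (intro sum_mono le)
    also have "\<dots> = (\<Sum>n\<in>k ` T. (1 / 2) ^ Suc n)" by (simp add: sum.reindex[OF injT])
    also have "\<dots> \<le> (\<Sum>n. (1 / 2) ^ Suc n)"
      using T(1) power_half_series by (intro sum_le_suminf) (auto dest: sums_summable)
    also have "\<dots> = 1" using power_half_series by (rule sums_unique[symmetric])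
    finally show ?thesis .
  qed
  ultimately show ?thesis unfolding equicontinuous_def using H by (auto simp: polar_def)
qed

lemma countable_discrete_imp_DF:
  fixes X :: "'x topology" and L :: "'v::real_vector topology"
  assumes cr: "completely_regular_space X" and haus: "Hausdorff_space X"
    and free: "free_lcs X L i" and count: "countable (topspace X)"
    and disc: "X = discrete_topology (topspace X)"
  shows "DF_space L"
proof -
  have L: "lcs L" using free by (simp add: free_lcs_def)
  have "equicontinuous L (\<Union>\<H>)" if "bounded_in (strong_dual L) (\<Union>\<H>)" for \<H>
  proof (rule countable_discrete_pointwise_bounded_equicontinuous[OF free count disc])
    show "\<Union>\<H> \<subseteq> dual L" using that by (simp add: bounded_in_def)
    show "\<exists>M. \<forall>\<phi>\<in>\<Union>\<H>. \<bar>\<phi> (i x)\<bar> \<le> M" if "x \<in> topspace X" for x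
      using bounded_in_strong_dual_pointwise[OF L \<open>bounded_in (strong_dual L) (\<Union>\<H>)\<close>]
        free_lcs_image[OF free that] by blast
  qed
  then have "aleph0_quasibarrelled L" by (simp add: aleph0_quasibarrelled_def)
  moreover obtain B where "fundamental_bounded_sequence L B"
    by (rule countable_discrete_fundamental_bounded_sequence[OF assms])
  ultimately show ?thesis using L by (auto simp: DF_space_def)
qed

theorem theorem1p4:
  fixes X :: "'x topology" and L :: "'v::real_vector topology" and i :: "'x \<Rightarrow> 'v"
  assumes "completely_regular_space X" and "Hausdorff_space X"
    and "free_lcs X L i"
  shows "(DF_space L \<longleftrightarrow> almost_DF_space L) \<and>
    (almost_DF_space L \<longleftrightarrow> countable (topspace X) \<and> X = discrete_topology (topspace X))"
  using DF_imp_almost_DF almost_DF_imp_countable_discrete[OF assms] countable_discrete_imp_DF[OF assms]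
  by blast

end
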